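(* Let $D$ be a continuous dcpo. (i) If $y\in D$ is sharp, then for every $x\in D$, $\neg(x\not\leq_{\mathrm S}y)$ implies $x\sqsubseteq y$. In particular, the intrinsic apartness is tight on sharp elements: if $x,y$ are sharp and $\neg(x\# y)$, then $x=y$. (ii) For all $x,y\in D$ and every sharp $z\in D$, if $x\# y$ then $x\# z$ or $y\# z$.
   Context: We work constructively: informal set theory without excluded middle or choice. A dcpo is a poset in which every directed subset (inhabited, any two elements have an upper bound in it) has a supremum. $x\ll y$ if for every directed $S$ with $y\sqsubseteq\bigsqcup S$ some $s\in S$ has $x\sqsubseteq s$; $D$ is continuous if for every $x$ the set $\{y\mid y\ll x\}$ is directed with supremum $x$. A subset is Scott open if it is an upper set and $\bigsqcup S\in U$ for directed $S$ implies some $s\in S$ lies in $U$. Write $x\not\leq_{\mathrm S}y$ if there is a Scott open set containing $x$ but not $y$. Intrinsic apartness: $x\# y$ iff ($x\not\leq_{\mathrm S}y$ or $y\not\leq_{\mathrm S}x$). An element $x$ is sharp if for all $u,v\in D$ with $u\ll v$ we have $u\ll x$ or $\neg(v\sqsubseteq x)$. *)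

theory Defs
  imports Main
begin

section \<open>Continuous dcpos in HOL\<close>

text \<open>
  The carrier is a set \<open>D\<close> and the order a relation \<open>r\<close> on it. As HOL is classical, every element
  is sharp in the sense below; the constructive content is expressed in the second half of this
  theory.
\<close>

definition directed_in :: "'a set \<Rightarrow> 'a rel \<Rightarrow> 'a set \<Rightarrow> bool" where
  "directed_in D r S \<longleftrightarrow> S \<subseteq> D \<and> (\<exists>x. x \<in> S) \<and>
     (\<forall>x\<in>S. \<forall>y\<in>S. \<exists>z\<in>S. (x, z) \<in> r \<and> (y, z) \<in> r)"

definition is_sup :: "'a set \<Rightarrow> 'a rel \<Rightarrow> 'a set \<Rightarrow> 'a \<Rightarrow> bool" where
  "is_sup D r S s \<longleftrightarrow> s \<in> D \<and> (\<forall>x\<in>S. (x, s) \<in> r) \<and>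
     (\<forall>b\<in>D. (\<forall>x\<in>S. (x, b) \<in> r) \<longrightarrow> (s, b) \<in> r)"

definition dcpo :: "'a set \<Rightarrow> 'a rel \<Rightarrow> bool" where
  "dcpo D r \<longleftrightarrow> partial_order_on D r \<and> (\<forall>S. directed_in D r S \<longrightarrow> (\<exists>s. is_sup D r S s))"

definition way_below :: "'a set \<Rightarrow> 'a rel \<Rightarrow> 'a \<Rightarrow> 'a \<Rightarrow> bool" where
  "way_below D r x y \<longleftrightarrow>
     (\<forall>S t. directed_in D r S \<longrightarrow> is_sup D r S t \<longrightarrow> (y, t) \<in> r \<longrightarrow> (\<exists>s\<in>S. (x, s) \<in> r))"

definition continuous_dcpo :: "'a set \<Rightarrow> 'a rel \<Rightarrow> bool" where
  "continuous_dcpo D r \<longleftrightarrow> dcpo D r \<and>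
     (\<forall>x\<in>D. directed_in D r {y \<in> D. way_below D r y x} \<and> is_sup D r {y \<in> D. way_below D r y x} x)"

definition scott_open :: "'a set \<Rightarrow> 'a rel \<Rightarrow> 'a set \<Rightarrow> bool" where
  "scott_open D r U \<longleftrightarrow> U \<subseteq> D \<and>
     (\<forall>x\<in>U. \<forall>y\<in>D. (x, y) \<in> r \<longrightarrow> y \<in> U) \<and>
     (\<forall>S t. directed_in D r S \<longrightarrow> is_sup D r S t \<longrightarrow> t \<in> U \<longrightarrow> (\<exists>s\<in>S. s \<in> U))"

definition scott_nle :: "'a set \<Rightarrow> 'a rel \<Rightarrow> 'a \<Rightarrow> 'a \<Rightarrow> bool" where
  "scott_nle D r x y \<longleftrightarrow> (\<exists>U. scott_open D r U \<and> x \<in> U \<and> y \<notin> U)"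

definition apart :: "'a set \<Rightarrow> 'a rel \<Rightarrow> 'a \<Rightarrow> 'a \<Rightarrow> bool" where
  "apart D r x y \<longleftrightarrow> scott_nle D r x y \<or> scott_nle D r y x"

definition sharp :: "'a set \<Rightarrow> 'a rel \<Rightarrow> 'a \<Rightarrow> bool" where
  "sharp D r x \<longleftrightarrow> x \<in> D \<and>
     (\<forall>u\<in>D. \<forall>v\<in>D. way_below D r u v \<longrightarrow> way_below D r u x \<or> (v, x) \<notin> r)"


section \<open>Intuitionistic Zermelo-Fraenkel set theory\<close>

text \<open>
  ``Constructively'' means: provable in set theory over intuitionistic logic, without choice. We
  formalise this as derivability in IZF. Formulas are in de Bruijn notation; the only terms of the
  language are variables, so substitutions are renamings.
\<close>

datatype fm =
    FMem nat nat
  | FEq nat nat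
  | FBot
  | FAnd fm fm
  | FOr fm fm
  | FImp fm fm
  | FAll fm
  | FEx fm

definition lift :: "(nat \<Rightarrow> nat) \<Rightarrow> nat \<Rightarrow> nat" where
  "lift f = case_nat 0 (\<lambda>i. Suc (f i))"

primrec ren :: "(nat \<Rightarrow> nat) \<Rightarrow> fm \<Rightarrow> fm" where
  "ren f (FMem i j) = FMem (f i) (f j)"
| "ren f (FEq i j) = FEq (f i) (f j)"
| "ren f FBot = FBot"
| "ren f (FAnd p q) = FAnd (ren f p) (ren f q)"
| "ren f (FOr p q) = FOr (ren f p) (ren f q)"
| "ren f (FImp p q) = FImp (ren f p) (ren f q)"
| "ren f (FAll p) = FAll (ren (lift f) p)"
| "ren f (FEx p) = FEx (ren (lift f) p)"

text \<open>Instantiation of the outermost bound variable (index 0) by the variable \<open>t\<close>.\<close>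

definition inst :: "nat \<Rightarrow> fm \<Rightarrow> fm" where
  "inst t = ren (case_nat t (\<lambda>i. i))"

subsection \<open>Named binders\<close>

text \<open>
  To write formulas readably, variables are given as de Bruijn levels and a formula as a function
  of the number \<open>n\<close> of enclosing quantifiers: the variable bound by the \<open>k\<close>-th quantifier from the
  outside (\<open>k = 0, 1, \<dots>\<close>) has level \<open>k\<close>, hence index \<open>n - Suc k\<close> below \<open>n\<close> quantifiers. In
  \<open>\<^bold>\<forall>x. F x\<close>, the HOL variable \<open>x\<close> stands for the level of the new bound variable. A sentence is
  obtained at \<open>n = 0\<close>.
\<close>

type_synonym form = "nat \<Rightarrow> fm"

definition f_mem :: "nat \<Rightarrow> nat \<Rightarrow> form" (infix "\<^bold>\<in>" 50) where
  "(x \<^bold>\<in> y) = (\<lambda>n. FMem (n - Suc x) (n - Suc y))"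
definition f_eq :: "nat \<Rightarrow> nat \<Rightarrow> form" (infix "\<^bold>=" 50) where
  "(x \<^bold>= y) = (\<lambda>n. FEq (n - Suc x) (n - Suc y))"
definition f_and :: "form \<Rightarrow> form \<Rightarrow> form" (infixr "\<^bold>\<and>" 35) where
  "(F \<^bold>\<and> G) = (\<lambda>n. FAnd (F n) (G n))"
definition f_or :: "form \<Rightarrow> form \<Rightarrow> form" (infixr "\<^bold>\<or>" 30) where
  "(F \<^bold>\<or> G) = (\<lambda>n. FOr (F n) (G n))"
definition f_imp :: "form \<Rightarrow> form \<Rightarrow> form" (infixr "\<^bold>\<longrightarrow>" 25) where
  "(F \<^bold>\<longrightarrow> G) = (\<lambda>n. FImp (F n) (G n))"
definition f_iff :: "form \<Rightarrow> form \<Rightarrow> form" (infixr "\<^bold>\<longleftrightarrow>" 25) where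
  "(F \<^bold>\<longleftrightarrow> G) = ((F \<^bold>\<longrightarrow> G) \<^bold>\<and> (G \<^bold>\<longrightarrow> F))"
definition f_not :: "form \<Rightarrow> form" ("\<^bold>\<not> _" [40] 40) where
  "(\<^bold>\<not> F) = (F \<^bold>\<longrightarrow> (\<lambda>n. FBot))"
definition f_all :: "(nat \<Rightarrow> form) \<Rightarrow> form" (binder "\<^bold>\<forall>" 10) where
  "f_all F = (\<lambda>n. FAll (F n (Suc n)))"
definition f_ex :: "(nat \<Rightarrow> form) \<Rightarrow> form" (binder "\<^bold>\<exists>" 10) where
  "f_ex F = (\<lambda>n. FEx (F n (Suc n)))"

text \<open>
  For the axiom schemata: \<open>at p xs\<close> is \<open>p\<close> with its first variables (indices
  \<open>0, \<dots>, length xs - 1\<close>) interpreted by the bound variables \<open>xs\<close>. The other free variables of \<open>p\<close>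
  are parameters; they remain free in the axiom and cannot be captured by its quantifiers.
\<close>

definition at :: "fm \<Rightarrow> nat list \<Rightarrow> form" where
  "at p xs = (\<lambda>n. ren (\<lambda>i. if i < length xs then n - Suc (xs ! i) else n + (i - length xs)) p)"

subsection \<open>Axioms and deductions\<close>

inductive_set IZF :: "fm set" where
  extensionality: "(\<^bold>\<forall>a. \<^bold>\<forall>b. (\<^bold>\<forall>x. x \<^bold>\<in> a \<^bold>\<longleftrightarrow> x \<^bold>\<in> b) \<^bold>\<longrightarrow> a \<^bold>= b) 0 \<in> IZF"
| pairing: "(\<^bold>\<forall>a. \<^bold>\<forall>b. \<^bold>\<exists>c. \<^bold>\<forall>x. x \<^bold>\<in> c \<^bold>\<longleftrightarrow> x \<^bold>= a \<^bold>\<or> x \<^bold>= b) 0 \<in> IZF"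
| union: "(\<^bold>\<forall>a. \<^bold>\<exists>c. \<^bold>\<forall>x. x \<^bold>\<in> c \<^bold>\<longleftrightarrow> (\<^bold>\<exists>y. y \<^bold>\<in> a \<^bold>\<and> x \<^bold>\<in> y)) 0 \<in> IZF"
| powerset: "(\<^bold>\<forall>a. \<^bold>\<exists>c. \<^bold>\<forall>x. x \<^bold>\<in> c \<^bold>\<longleftrightarrow> (\<^bold>\<forall>y. y \<^bold>\<in> x \<^bold>\<longrightarrow> y \<^bold>\<in> a)) 0 \<in> IZF"
| infinity: "(\<^bold>\<exists>a. (\<^bold>\<exists>x. x \<^bold>\<in> a \<^bold>\<and> (\<^bold>\<forall>y. \<^bold>\<not> y \<^bold>\<in> x)) \<^bold>\<and>
    (\<^bold>\<forall>x. x \<^bold>\<in> a \<^bold>\<longrightarrow> (\<^bold>\<exists>y. y \<^bold>\<in> a \<^bold>\<and> (\<^bold>\<forall>z. z \<^bold>\<in> y \<^bold>\<longleftrightarrow> z \<^bold>\<in> x \<^bold>\<or> z \<^bold>= x)))) 0 \<in> IZF"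
| separation: "(\<^bold>\<forall>a. \<^bold>\<exists>b. \<^bold>\<forall>x. x \<^bold>\<in> b \<^bold>\<longleftrightarrow> x \<^bold>\<in> a \<^bold>\<and> at p [x]) 0 \<in> IZF"
| collection: "(\<^bold>\<forall>a. (\<^bold>\<forall>x. x \<^bold>\<in> a \<^bold>\<longrightarrow> (\<^bold>\<exists>y. at p [x, y])) \<^bold>\<longrightarrow>
    (\<^bold>\<exists>b. \<^bold>\<forall>x. x \<^bold>\<in> a \<^bold>\<longrightarrow> (\<^bold>\<exists>y. y \<^bold>\<in> b \<^bold>\<and> at p [x, y]))) 0 \<in> IZF"
| induction: "((\<^bold>\<forall>x. (\<^bold>\<forall>y. y \<^bold>\<in> x \<^bold>\<longrightarrow> at p [y]) \<^bold>\<longrightarrow> at p [x]) \<^bold>\<longrightarrow> (\<^bold>\<forall>x. at p [x])) 0 \<in> IZF"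

text \<open>Natural deduction for intuitionistic first-order logic with equality, with the axioms of IZF.\<close>

inductive derives :: "fm list \<Rightarrow> fm \<Rightarrow> bool" (infix "\<turnstile>" 50) where
  Hyp: "p \<in> set G \<Longrightarrow> G \<turnstile> p"
| Axiom: "p \<in> IZF \<Longrightarrow> G \<turnstile> p"
| BotE: "G \<turnstile> FBot \<Longrightarrow> G \<turnstile> p"
| AndI: "G \<turnstile> p \<Longrightarrow> G \<turnstile> q \<Longrightarrow> G \<turnstile> FAnd p q"
| AndE1: "G \<turnstile> FAnd p q \<Longrightarrow> G \<turnstile> p"
| AndE2: "G \<turnstile> FAnd p q \<Longrightarrow> G \<turnstile> q"
| OrI1: "G \<turnstile> p \<Longrightarrow> G \<turnstile> FOr p q"
| OrI2: "G \<turnstile> q \<Longrightarrow> G \<turnstile> FOr p q"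
| OrE: "G \<turnstile> FOr p q \<Longrightarrow> p # G \<turnstile> s \<Longrightarrow> q # G \<turnstile> s \<Longrightarrow> G \<turnstile> s"
| ImpI: "p # G \<turnstile> q \<Longrightarrow> G \<turnstile> FImp p q"
| ImpE: "G \<turnstile> FImp p q \<Longrightarrow> G \<turnstile> p \<Longrightarrow> G \<turnstile> q"
| AllI: "map (ren Suc) G \<turnstile> p \<Longrightarrow> G \<turnstile> FAll p"
| AllE: "G \<turnstile> FAll p \<Longrightarrow> G \<turnstile> inst t p"
| ExI: "G \<turnstile> inst t p \<Longrightarrow> G \<turnstile> FEx p"
| ExE: "G \<turnstile> FEx p \<Longrightarrow> p # map (ren Suc) G \<turnstile> ren Suc q \<Longrightarrow> G \<turnstile> q"
| EqI: "G \<turnstile> FEq t t"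
| EqE: "G \<turnstile> FEq s t \<Longrightarrow> G \<turnstile> inst s p \<Longrightarrow> G \<turnstile> inst t p"


section \<open>Continuous dcpos in the language of set theory\<close>

text \<open>The set \<open>R\<close> contains the Kuratowski pair \<open>{{x}, {x, y}}\<close>.\<close>

definition f_upair :: "nat \<Rightarrow> nat \<Rightarrow> nat \<Rightarrow> form" where
  "f_upair p x y = (\<^bold>\<forall>z. z \<^bold>\<in> p \<^bold>\<longleftrightarrow> z \<^bold>= x \<^bold>\<or> z \<^bold>= y)"

definition f_pair :: "nat \<Rightarrow> nat \<Rightarrow> nat \<Rightarrow> form" where
  "f_pair p x y = (\<^bold>\<forall>z. z \<^bold>\<in> p \<^bold>\<longleftrightarrow> f_upair z x x \<^bold>\<or> f_upair z x y)"

definition f_le :: "nat \<Rightarrow> nat \<Rightarrow> nat \<Rightarrow> form" where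
  "f_le R x y = (\<^bold>\<exists>p. f_pair p x y \<^bold>\<and> p \<^bold>\<in> R)"

definition f_subset :: "nat \<Rightarrow> nat \<Rightarrow> form" where
  "f_subset A B = (\<^bold>\<forall>x. x \<^bold>\<in> A \<^bold>\<longrightarrow> x \<^bold>\<in> B)"

text \<open>Only the part of \<open>R\<close> on \<open>D \<times> D\<close> matters, so \<open>R \<subseteq> D \<times> D\<close> is not required.\<close>

definition f_poset :: "nat \<Rightarrow> nat \<Rightarrow> form" where
  "f_poset D R =
     ((\<^bold>\<forall>x. x \<^bold>\<in> D \<^bold>\<longrightarrow> f_le R x x) \<^bold>\<and>
      (\<^bold>\<forall>x. x \<^bold>\<in> D \<^bold>\<longrightarrow> (\<^bold>\<forall>y. y \<^bold>\<in> D \<^bold>\<longrightarrow> (\<^bold>\<forall>z. z \<^bold>\<in> D \<^bold>\<longrightarrow> f_le R x y \<^bold>\<longrightarrow> f_le R y z \<^bold>\<longrightarrow> f_le R x z))) \<^bold>\<and>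
      (\<^bold>\<forall>x. x \<^bold>\<in> D \<^bold>\<longrightarrow> (\<^bold>\<forall>y. y \<^bold>\<in> D \<^bold>\<longrightarrow> f_le R x y \<^bold>\<longrightarrow> f_le R y x \<^bold>\<longrightarrow> x \<^bold>= y)))"

definition f_directed :: "nat \<Rightarrow> nat \<Rightarrow> nat \<Rightarrow> form" where
  "f_directed D R S =
     (f_subset S D \<^bold>\<and> (\<^bold>\<exists>x. x \<^bold>\<in> S) \<^bold>\<and>
      (\<^bold>\<forall>x. x \<^bold>\<in> S \<^bold>\<longrightarrow> (\<^bold>\<forall>y. y \<^bold>\<in> S \<^bold>\<longrightarrow> (\<^bold>\<exists>z. z \<^bold>\<in> S \<^bold>\<and> f_le R x z \<^bold>\<and> f_le R y z))))"

definition f_sup :: "nat \<Rightarrow> nat \<Rightarrow> nat \<Rightarrow> nat \<Rightarrow> form" where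
  "f_sup D R S s =
     (s \<^bold>\<in> D \<^bold>\<and> (\<^bold>\<forall>x. x \<^bold>\<in> S \<^bold>\<longrightarrow> f_le R x s) \<^bold>\<and>
      (\<^bold>\<forall>b. b \<^bold>\<in> D \<^bold>\<longrightarrow> (\<^bold>\<forall>x. x \<^bold>\<in> S \<^bold>\<longrightarrow> f_le R x b) \<^bold>\<longrightarrow> f_le R s b))"

definition f_dcpo :: "nat \<Rightarrow> nat \<Rightarrow> form" where
  "f_dcpo D R = (f_poset D R \<^bold>\<and> (\<^bold>\<forall>S. f_directed D R S \<^bold>\<longrightarrow> (\<^bold>\<exists>s. f_sup D R S s)))"

definition f_way_below :: "nat \<Rightarrow> nat \<Rightarrow> nat \<Rightarrow> nat \<Rightarrow> form" where
  "f_way_below D R x y =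
     (\<^bold>\<forall>S. \<^bold>\<forall>t. f_directed D R S \<^bold>\<longrightarrow> f_sup D R S t \<^bold>\<longrightarrow> f_le R y t \<^bold>\<longrightarrow> (\<^bold>\<exists>s. s \<^bold>\<in> S \<^bold>\<and> f_le R x s))"

text \<open>The set \<open>A\<close> below is \<open>{y \<in> D | y \<lless> x}\<close>.\<close>

definition f_continuous_dcpo :: "nat \<Rightarrow> nat \<Rightarrow> form" where
  "f_continuous_dcpo D R =
     (f_dcpo D R \<^bold>\<and>
      (\<^bold>\<forall>x. x \<^bold>\<in> D \<^bold>\<longrightarrow> (\<^bold>\<exists>A. (\<^bold>\<forall>y. y \<^bold>\<in> A \<^bold>\<longleftrightarrow> y \<^bold>\<in> D \<^bold>\<and> f_way_below D R y x) \<^bold>\<and>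
        f_directed D R A \<^bold>\<and> f_sup D R A x)))"

definition f_scott_open :: "nat \<Rightarrow> nat \<Rightarrow> nat \<Rightarrow> form" where
  "f_scott_open D R U =
     (f_subset U D \<^bold>\<and>
      (\<^bold>\<forall>x. x \<^bold>\<in> U \<^bold>\<longrightarrow> (\<^bold>\<forall>y. y \<^bold>\<in> D \<^bold>\<longrightarrow> f_le R x y \<^bold>\<longrightarrow> y \<^bold>\<in> U)) \<^bold>\<and>
      (\<^bold>\<forall>S. \<^bold>\<forall>t. f_directed D R S \<^bold>\<longrightarrow> f_sup D R S t \<^bold>\<longrightarrow> t \<^bold>\<in> U \<^bold>\<longrightarrow> (\<^bold>\<exists>s. s \<^bold>\<in> S \<^bold>\<and> s \<^bold>\<in> U)))"

definition f_scott_nle :: "nat \<Rightarrow> nat \<Rightarrow> nat \<Rightarrow> nat \<Rightarrow> form" where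
  "f_scott_nle D R x y = (\<^bold>\<exists>U. f_scott_open D R U \<^bold>\<and> x \<^bold>\<in> U \<^bold>\<and> \<^bold>\<not> (y \<^bold>\<in> U))"

definition f_apart :: "nat \<Rightarrow> nat \<Rightarrow> nat \<Rightarrow> nat \<Rightarrow> form" where
  "f_apart D R x y = (f_scott_nle D R x y \<^bold>\<or> f_scott_nle D R y x)"

definition f_sharp :: "nat \<Rightarrow> nat \<Rightarrow> nat \<Rightarrow> form" where
  "f_sharp D R x =
     (x \<^bold>\<in> D \<^bold>\<and>
      (\<^bold>\<forall>u. u \<^bold>\<in> D \<^bold>\<longrightarrow> (\<^bold>\<forall>v. v \<^bold>\<in> D \<^bold>\<longrightarrow> f_way_below D R u v \<^bold>\<longrightarrow>
        f_way_below D R u x \<^bold>\<or> \<^bold>\<not> f_le R v x)))"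

end

(* For the constructive half, derivability from the hypothesis "D is a continuous dcpo" is turned into
   a forcing relation, so that the constructive argument becomes reasoning about worlds. The argument:
   x is the supremum of the v << x, and each such v that is not below y puts x in the Scott open set
   {w | v << w}, from which y is missing. Sharpness of y decides, for u << v, between u << y and
   "v is not below y", which gives (i) by letting u run through the approximants of v. For (ii), a
   Scott open U containing x but not y contains some u << v << x, and sharpness of z applied to
   u << v puts z in U or outside {w | v << w}. *)

theory Submission
  imports Defs
begin

section \<open>Renaming and weakening of derivations\<close>

text \<open>Forcing is derivability itself: each clause reads the introduction and elimination rules
  of a connective as an equivalence. Statements about worlds are ordinary HOL propositions, so
  classical automation on them adds no classical strength to what is derived. The price is that in
  general neither a witness of an existential statement nor a side of a disjunction can be picked at
  a world. Such steps pass to extensions, along which all facts have to be carried by monotonicity;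
  hence the chains of worlds \<open>G\<close>, \<open>H\<close>, \<open>K\<close>, ... Generic
  elements are fresh variables, which is why derivations are first shown stable under renaming. Sets
  have to be produced by separation: {w | v << w} is one, the other is the set behind interpolation.
  Interpolation is what makes the former Scott open: if v << t and t is the supremum of S, the
  definition only gives v \<sqsubseteq> s for some s in S, whereas v << s is wanted.\<close>

lemma lift_0 [simp]: "lift f 0 = 0"
  by (simp add: lift_def)

lemma lift_Suc [simp]: "lift f (Suc i) = Suc (f i)"
  by (simp add: lift_def)

lemma lift_comp: "lift f \<circ> lift g = lift (f \<circ> g)"
  by (rule ext) (simp add: lift_def split: nat.split)

lemma lift_id: "lift (\<lambda>i. i) = (\<lambda>i. i)"
  by (rule ext) (simp add: lift_def split: nat.split)

lemma ren_ren: "ren f (ren g p) = ren (f \<circ> g) p"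
  by (induction p arbitrary: f g) (simp_all add: lift_comp)

lemma ren_id: "ren (\<lambda>i. i) p = p"
  by (induction p) (simp_all add: lift_id)

lemma ren_eqI: "(\<And>i. f i = g i) \<Longrightarrow> ren f p = ren g p"
  by (rule arg_cong[where f = "\<lambda>h. ren h p"]) (rule ext)

lemma ren_inst: "ren f (inst t p) = inst (f t) (ren (lift f) p)"
  unfolding inst_def ren_ren
  by (rule ren_eqI) (simp split: nat.split)

text \<open>A formula mentions finitely many variables, which is what supplies fresh ones for the
  quantifier rules. Below a quantifier the same bound \<open>N\<close> serves, since
  \<open>lift f\<close> at \<open>Suc i\<close> only consults \<open>f\<close> at
  \<open>i\<close>.\<close>

lemma ren_finite_support: "\<exists>N. \<forall>f g. (\<forall>i<N. f i = g i) \<longrightarrow> ren f p = ren g p"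
proof (induction p)
  case (FMem i j)
  show ?case by (rule exI[of _ "Suc (max i j)"]) auto
next
  case (FEq i j)
  show ?case by (rule exI[of _ "Suc (max i j)"]) auto
next
  case (FAnd p q)
  then obtain M N where "\<forall>f g. (\<forall>i<M. f i = g i) \<longrightarrow> ren f p = ren g p"
    "\<forall>f g. (\<forall>i<N. f i = g i) \<longrightarrow> ren f q = ren g q" by blast
  then show ?case by (intro exI[of _ "max M N"]) (simp add: less_max_iff_disj)
next
  case (FOr p q)
  then obtain M N where "\<forall>f g. (\<forall>i<M. f i = g i) \<longrightarrow> ren f p = ren g p"
    "\<forall>f g. (\<forall>i<N. f i = g i) \<longrightarrow> ren f q = ren g q" by blast
  then show ?case by (intro exI[of _ "max M N"]) (simp add: less_max_iff_disj)
next
  case (FImp p q)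
  then obtain M N where "\<forall>f g. (\<forall>i<M. f i = g i) \<longrightarrow> ren f p = ren g p"
    "\<forall>f g. (\<forall>i<N. f i = g i) \<longrightarrow> ren f q = ren g q" by blast
  then show ?case by (intro exI[of _ "max M N"]) (simp add: less_max_iff_disj)
next
  case (FAll p)
  then obtain N where N: "\<forall>f g. (\<forall>i<N. f i = g i) \<longrightarrow> ren f p = ren g p" by blast
  show ?case
  proof (intro exI[of _ N] allI impI)
    fix f g :: "nat \<Rightarrow> nat" assume "\<forall>i<N. f i = g i"
    then have "\<forall>i<N. lift f i = lift g i" by (auto simp: lift_def split: nat.split)
    then show "ren f (FAll p) = ren g (FAll p)" using N by simp
  qed
next
  case (FEx p)
  then obtain N where N: "\<forall>f g. (\<forall>i<N. f i = g i) \<longrightarrow> ren f p = ren g p" by blast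
  show ?case
  proof (intro exI[of _ N] allI impI)
    fix f g :: "nat \<Rightarrow> nat" assume "\<forall>i<N. f i = g i"
    then have "\<forall>i<N. lift f i = lift g i" by (auto simp: lift_def split: nat.split)
    then show "ren f (FEx p) = ren g (FEx p)" using N by simp
  qed
qed simp

lemma ren_finite_support_list:
  "\<exists>N. \<forall>p\<in>set G. \<forall>f g. (\<forall>i<N. f i = g i) \<longrightarrow> ren f p = ren g p"
proof (induction G)
  case (Cons p G)
  then obtain M where M: "\<forall>p\<in>set G. \<forall>f g. (\<forall>i<M. f i = g i) \<longrightarrow> ren f p = ren g p" by blast
  obtain N where N: "\<forall>f g. (\<forall>i<N. f i = g i) \<longrightarrow> ren f p = ren g p"
    using ren_finite_support by blast
  show ?case using M N by (intro exI[of _ "max M N"]) (simp add: less_max_iff_disj)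
qed simp

section \<open>Stability of IZF and of derivability under renaming\<close>

lemmas connective_defs = f_mem_def f_eq_def f_and_def f_or_def f_imp_def f_iff_def f_not_def
  f_all_def f_ex_def

text \<open>The single axioms are sentences, which a renaming fixes. An instance of a schema becomes
  the instance for a renamed formula: the indices that \<open>at\<close> interprets by bound
  variables stay in place, so \<open>f\<close> is lifted once for separation and induction and twice
  for collection.\<close>

lemma IZF_ren:
  assumes "p \<in> IZF"
  shows "ren f p \<in> IZF"
  using assms
proof cases
  case extensionality
  then have "ren f p = p" by (simp add: connective_defs eval_nat_numeral)
  then show ?thesis using assms by simp
next
  case pairing
  then have "ren f p = p" by (simp add: connective_defs eval_nat_numeral)
  then show ?thesis using assms by simp
next
  case union
  then have "ren f p = p" by (simp add: connective_defs eval_nat_numeral)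
  then show ?thesis using assms by simp
next
  case powerset
  then have "ren f p = p" by (simp add: connective_defs eval_nat_numeral)
  then show ?thesis using assms by simp
next
  case infinity
  then have "ren f p = p" by (simp add: connective_defs eval_nat_numeral)
  then show ?thesis using assms by simp
next
  case (separation q)
  have "ren f p = (\<^bold>\<forall>a. \<^bold>\<exists>b. \<^bold>\<forall>x. x \<^bold>\<in> b \<^bold>\<longleftrightarrow> x \<^bold>\<in> a \<^bold>\<and> at (ren (lift f) q) [x]) 0"
    by (simp add: connective_defs at_def ren_ren eval_nat_numeral separation, rule ren_eqI, rename_tac i, case_tac i, simp_all)
  then show ?thesis by (simp only: IZF.separation)
next
  case (collection q)
  have "ren f p = (\<^bold>\<forall>a. (\<^bold>\<forall>x. x \<^bold>\<in> a \<^bold>\<longrightarrow> (\<^bold>\<exists>y. at (ren (lift (lift f)) q) [x, y])) \<^bold>\<longrightarrow>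
    (\<^bold>\<exists>b. \<^bold>\<forall>x. x \<^bold>\<in> a \<^bold>\<longrightarrow> (\<^bold>\<exists>y. y \<^bold>\<in> b \<^bold>\<and> at (ren (lift (lift f)) q) [x, y]))) 0"
    by (simp add: connective_defs at_def ren_ren eval_nat_numeral collection)
      (intro conjI; rule ren_eqI, rename_tac i, case_tac i, simp, rename_tac j, case_tac j, simp_all)
  then show ?thesis by (simp only: IZF.collection)
next
  case (induction q)
  have "ren f p = ((\<^bold>\<forall>x. (\<^bold>\<forall>y. y \<^bold>\<in> x \<^bold>\<longrightarrow> at (ren (lift f) q) [y]) \<^bold>\<longrightarrow>
      at (ren (lift f) q) [x]) \<^bold>\<longrightarrow> (\<^bold>\<forall>x. at (ren (lift f) q) [x])) 0"
    by (simp add: connective_defs at_def ren_ren eval_nat_numeral induction)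
      (intro conjI; rule ren_eqI, rename_tac i, case_tac i, simp_all)
  then show ?thesis by (simp only: IZF.induction)
qed

text \<open>Renaming and weakening are proved together because some rules enlarge the context and
  the quantifier rules shift it; hence \<open>f\<close> and \<open>H\<close> vary in the induction.
  Even a renaming that identifies variables is admissible: freshness is built into the shift
  \<open>ren Suc\<close> of the context, and \<open>lift f\<close> after \<open>Suc\<close> is
  \<open>Suc\<close> after \<open>f\<close>.\<close>

lemma derives_ren: "G \<turnstile> p \<Longrightarrow> ren f ` set G \<subseteq> set H \<Longrightarrow> H \<turnstile> ren f p"
proof (induction arbitrary: f H rule: derives.induct)
  case (Hyp p G)
  then show ?case by (intro derives.Hyp) auto
next
  case (Axiom p G)
  then show ?case by (intro derives.Axiom IZF_ren)
next
  case (BotE G p)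
  then show ?case by (simp add: derives.BotE)
next
  case (AndI G p q)
  then show ?case by (simp add: derives.AndI)
next
  case (AndE1 G p q)
  then have "H \<turnstile> FAnd (ren f p) (ren f q)" by simp
  then show ?case by (rule derives.AndE1)
next
  case (AndE2 G p q)
  then have "H \<turnstile> FAnd (ren f p) (ren f q)" by simp
  then show ?case by (rule derives.AndE2)
next
  case (OrI1 G p q)
  then show ?case by (simp add: derives.OrI1)
next
  case (OrI2 G q p)
  then show ?case by (simp add: derives.OrI2)
next
  case (OrE G p q s)
  have "ren f ` set (p # G) \<subseteq> set (ren f p # H)" "ren f ` set (q # G) \<subseteq> set (ren f q # H)"
    using OrE.prems by auto
  then have "ren f p # H \<turnstile> ren f s" "ren f q # H \<turnstile> ren f s"
    using OrE.IH(2)[of f "ren f p # H"] OrE.IH(3)[of f "ren f q # H"] by simp_all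
  moreover have "H \<turnstile> FOr (ren f p) (ren f q)" using OrE.IH(1)[OF OrE.prems] by simp
  ultimately show ?case using derives.OrE by blast
next
  case (ImpI p G q)
  then have "ren f ` set (p # G) \<subseteq> set (ren f p # H)" by auto
  then have "ren f p # H \<turnstile> ren f q" by (rule ImpI.IH)
  then show ?case by (simp add: derives.ImpI)
next
  case (ImpE G p q)
  then have "H \<turnstile> FImp (ren f p) (ren f q)" "H \<turnstile> ren f p" by simp_all
  then show ?case by (rule derives.ImpE)
next
  case (AllI G p)
  have "map (ren Suc) H \<turnstile> ren (lift f) p"
  proof (rule AllI.IH)
    have "ren (lift f) (ren Suc q) \<in> ren Suc ` set H" if "q \<in> set G" for q
    proof -
      have "ren (lift f) (ren Suc q) = ren Suc (ren f q)"
        by (simp add: ren_ren comp_def)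
      then show ?thesis using that AllI.prems by auto
    qed
    then show "ren (lift f) ` set (map (ren Suc) G) \<subseteq> set (map (ren Suc) H)" by auto
  qed
  then show ?case by (simp add: derives.AllI)
next
  case (AllE G p t)
  then have "H \<turnstile> FAll (ren (lift f) p)" by simp
  then show ?case unfolding ren_inst by (rule derives.AllE)
next
  case (ExI G t p)
  then have "H \<turnstile> inst (f t) (ren (lift f) p)" by (simp add: ren_inst)
  then show ?case unfolding ren.simps by (rule derives.ExI)
next
  case (ExE G p q)
  have comm: "ren (lift f) (ren Suc q) = ren Suc (ren f q)" for q
    by (simp add: ren_ren comp_def)
  have "ren (lift f) p # map (ren Suc) H \<turnstile> ren (lift f) (ren Suc q)"
  proof (rule ExE.IH(2))
    have "ren (lift f) (ren Suc q) \<in> ren Suc ` set H" if "q \<in> set G" for q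
      using that ExE.prems unfolding comm by auto
    then show "ren (lift f) ` set (p # map (ren Suc) G)
      \<subseteq> set (ren (lift f) p # map (ren Suc) H)" by auto
  qed
  moreover have "H \<turnstile> FEx (ren (lift f) p)" using ExE.IH(1)[OF ExE.prems] by simp
  ultimately show ?case unfolding comm by (rule derives.ExE[rotated])
next
  case (EqI G t)
  then show ?case by (simp add: derives.EqI)
next
  case (EqE G s t p)
  then have "H \<turnstile> FEq (f s) (f t)" "H \<turnstile> inst (f s) (ren (lift f) p)" by (simp_all add: ren_inst)
  then show ?case unfolding ren_inst by (rule derives.EqE)
qed

lemma derives_weaken: "G \<turnstile> p \<Longrightarrow> set G \<subseteq> set H \<Longrightarrow> H \<turnstile> p"
  using derives_ren[where f = "\<lambda>i. i"] by (simp add: ren_id)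

text \<open>Renaming a fresh variable \<open>N\<close> to the index 0 turns an instance back into the scope of the
  quantifier.\<close>

lemma derives_inst_fresh:
  "\<exists>N. G \<turnstile> inst N p \<longrightarrow> map (ren Suc) G \<turnstile> p"
  and derives_inst_fresh_hyp:
  "\<exists>N. inst N p # G \<turnstile> q \<longrightarrow> p # map (ren Suc) G \<turnstile> ren Suc q"
proof -
  obtain N where N: "\<And>r f g. r \<in> set (p # q # G) \<Longrightarrow> (\<And>i. i < N \<Longrightarrow> f i = g i) \<Longrightarrow> ren f r = ren g r"
    using ren_finite_support_list[of "p # q # G"] by blast
  \<comment> \<open>\<open>f\<close> undoes the instantiation at \<open>N\<close>, which sends 0 to
    \<open>N\<close> and lowers every other index by one. As \<open>N\<close> bounds all indices
    that matter, \<open>f\<close> acts on the given formulas as the plain shift.\<close>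
  define f where "f i = (if i = N then 0 else Suc i)" for i
  have Suc: "ren f r = ren Suc r" if "r \<in> set (p # q # G)" for r
    by (rule N[OF that]) (simp add: f_def)
  have "ren (f \<circ> case_nat N (\<lambda>i. i)) p = ren (\<lambda>i. i) p"
    by (rule N) (auto simp: f_def split: nat.split)
  then have inst: "ren f (inst N p) = p" by (simp add: inst_def ren_ren ren_id)
  have G: "ren f ` set G \<subseteq> set (map (ren Suc) G)" using Suc by auto
  show "\<exists>N. G \<turnstile> inst N p \<longrightarrow> map (ren Suc) G \<turnstile> p"
    using derives_ren[of G "inst N p" f "map (ren Suc) G"] G inst by (intro exI[of _ N]) simp
  show "\<exists>N. inst N p # G \<turnstile> q \<longrightarrow> p # map (ren Suc) G \<turnstile> ren Suc q"
    using derives_ren[of "inst N p # G" q f "p # map (ren Suc) G"] G inst Suc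
    by (intro exI[of _ N]) auto
qed

section \<open>The defined predicates as formulas in their free variables\<close>

text \<open>Unlike in the definitions they mirror, the arguments are de Bruijn indices here, so that
  a renaming acts on a formula by acting on its arguments.\<close>

abbreviation FIff :: "fm \<Rightarrow> fm \<Rightarrow> fm" where
  "FIff p q \<equiv> FAnd (FImp p q) (FImp q p)"

abbreviation FNot :: "fm \<Rightarrow> fm" where
  "FNot p \<equiv> FImp p FBot"

definition upair_fm :: "nat \<Rightarrow> nat \<Rightarrow> nat \<Rightarrow> fm" where
  "upair_fm p x y = FAll (FIff (FMem 0 (Suc p)) (FOr (FEq 0 (Suc x)) (FEq 0 (Suc y))))"

definition pair_fm :: "nat \<Rightarrow> nat \<Rightarrow> nat \<Rightarrow> fm" where
  "pair_fm p x y = FAll (FIff (FMem 0 (Suc p))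
     (FOr (upair_fm 0 (Suc x) (Suc x)) (upair_fm 0 (Suc x) (Suc y))))"

definition le_fm :: "nat \<Rightarrow> nat \<Rightarrow> nat \<Rightarrow> fm" where
  "le_fm R x y = FEx (FAnd (pair_fm 0 (Suc x) (Suc y)) (FMem 0 (Suc R)))"

definition subset_fm :: "nat \<Rightarrow> nat \<Rightarrow> fm" where
  "subset_fm A B = FAll (FImp (FMem 0 (Suc A)) (FMem 0 (Suc B)))"

text \<open>The suffix counts the quantifiers passed: \<open>D1\<close>, \<open>D2\<close>,
  \<open>D3\<close> all denote the set \<open>D\<close>, whose index grows by one below each
  binder.\<close>

definition poset_fm :: "nat \<Rightarrow> nat \<Rightarrow> fm" where
  "poset_fm D R =
     (let D1 = Suc D; D2 = Suc D1; D3 = Suc D2; R1 = Suc R; R2 = Suc R1; R3 = Suc R2 in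
      FAnd (FAll (FImp (FMem 0 D1) (le_fm R1 0 0)))
      (FAnd (FAll (FImp (FMem 0 D1) (FAll (FImp (FMem 0 D2) (FAll (FImp (FMem 0 D3)
         (FImp (le_fm R3 (Suc (Suc 0)) (Suc 0)) (FImp (le_fm R3 (Suc 0) 0)
           (le_fm R3 (Suc (Suc 0)) 0)))))))))
       (FAll (FImp (FMem 0 D1) (FAll (FImp (FMem 0 D2)
         (FImp (le_fm R2 (Suc 0) 0) (FImp (le_fm R2 0 (Suc 0)) (FEq (Suc 0) 0)))))))))"

definition directed_fm :: "nat \<Rightarrow> nat \<Rightarrow> nat \<Rightarrow> fm" where
  "directed_fm D R S =
     (let S1 = Suc S; S2 = Suc S1; S3 = Suc S2; R3 = Suc (Suc (Suc R)) in
      FAnd (subset_fm S D) (FAnd (FEx (FMem 0 S1))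
       (FAll (FImp (FMem 0 S1) (FAll (FImp (FMem 0 S2)
         (FEx (FAnd (FMem 0 S3) (FAnd (le_fm R3 (Suc (Suc 0)) 0) (le_fm R3 (Suc 0) 0))))))))))"

definition sup_fm :: "nat \<Rightarrow> nat \<Rightarrow> nat \<Rightarrow> nat \<Rightarrow> fm" where
  "sup_fm D R S s =
     (let R1 = Suc R; R2 = Suc R1; S1 = Suc S; S2 = Suc S1 in
      FAnd (FMem s D) (FAnd (FAll (FImp (FMem 0 S1) (le_fm R1 0 (Suc s))))
       (FAll (FImp (FMem 0 (Suc D)) (FImp (FAll (FImp (FMem 0 S2) (le_fm R2 0 (Suc 0))))
         (le_fm R1 (Suc s) 0))))))"

definition dcpo_fm :: "nat \<Rightarrow> nat \<Rightarrow> fm" where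
  "dcpo_fm D R = FAnd (poset_fm D R) (FAll (FImp (directed_fm (Suc D) (Suc R) 0)
     (FEx (sup_fm (Suc (Suc D)) (Suc (Suc R)) (Suc 0) 0))))"

definition way_below_fm :: "nat \<Rightarrow> nat \<Rightarrow> nat \<Rightarrow> nat \<Rightarrow> fm" where
  "way_below_fm D R x y =
     (let D2 = Suc (Suc D); R2 = Suc (Suc R) in
      FAll (FAll (FImp (directed_fm D2 R2 (Suc 0)) (FImp (sup_fm D2 R2 (Suc 0) 0)
       (FImp (le_fm R2 (Suc (Suc y)) 0)
         (FEx (FAnd (FMem 0 (Suc (Suc 0))) (le_fm (Suc R2) (Suc (Suc (Suc x))) 0))))))))"

definition continuous_dcpo_fm :: "nat \<Rightarrow> nat \<Rightarrow> fm" where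
  "continuous_dcpo_fm D R =
     (let D1 = Suc D; D2 = Suc D1; D3 = Suc D2; R2 = Suc (Suc R); R3 = Suc R2 in
      FAnd (dcpo_fm D R) (FAll (FImp (FMem 0 D1) (FEx (FAnd
        (FAll (FIff (FMem 0 (Suc 0)) (FAnd (FMem 0 D3) (way_below_fm D3 R3 0 (Suc (Suc 0))))))
        (FAnd (directed_fm D2 R2 0) (sup_fm D2 R2 0 (Suc 0))))))))"

definition scott_open_fm :: "nat \<Rightarrow> nat \<Rightarrow> nat \<Rightarrow> fm" where
  "scott_open_fm D R U =
     (let D2 = Suc (Suc D); R2 = Suc (Suc R); U1 = Suc U; U2 = Suc U1; U3 = Suc U2 in
      FAnd (subset_fm U D)
      (FAnd (FAll (FImp (FMem 0 U1) (FAll (FImp (FMem 0 D2)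
         (FImp (le_fm R2 (Suc 0) 0) (FMem 0 U2))))))
       (FAll (FAll (FImp (directed_fm D2 R2 (Suc 0)) (FImp (sup_fm D2 R2 (Suc 0) 0)
         (FImp (FMem 0 U2) (FEx (FAnd (FMem 0 (Suc (Suc 0))) (FMem 0 U3))))))))))"

definition scott_nle_fm :: "nat \<Rightarrow> nat \<Rightarrow> nat \<Rightarrow> nat \<Rightarrow> fm" where
  "scott_nle_fm D R x y = FEx (FAnd (scott_open_fm (Suc D) (Suc R) 0)
     (FAnd (FMem (Suc x) 0) (FNot (FMem (Suc y) 0))))"

definition apart_fm :: "nat \<Rightarrow> nat \<Rightarrow> nat \<Rightarrow> nat \<Rightarrow> fm" where
  "apart_fm D R x y = FOr (scott_nle_fm D R x y) (scott_nle_fm D R y x)"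

definition sharp_fm :: "nat \<Rightarrow> nat \<Rightarrow> nat \<Rightarrow> fm" where
  "sharp_fm D R x =
     (let D1 = Suc D; D2 = Suc D1; R2 = Suc (Suc R); x2 = Suc (Suc x) in
      FAnd (FMem x D) (FAll (FImp (FMem 0 D1) (FAll (FImp (FMem 0 D2)
       (FImp (way_below_fm D2 R2 (Suc 0) 0)
         (FOr (way_below_fm D2 R2 (Suc 0) x2) (FNot (le_fm R2 0 x2)))))))))"

section \<open>Action of renamings, and translation from levels to indices\<close>

lemma ren_upair_fm [simp]: "ren f (upair_fm p x y) = upair_fm (f p) (f x) (f y)"
  by (simp add: upair_fm_def)

lemma ren_pair_fm [simp]: "ren f (pair_fm p x y) = pair_fm (f p) (f x) (f y)"
  by (simp add: pair_fm_def)

lemma ren_le_fm [simp]: "ren f (le_fm R x y) = le_fm (f R) (f x) (f y)"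
  by (simp add: le_fm_def)

lemma ren_subset_fm [simp]: "ren f (subset_fm A B) = subset_fm (f A) (f B)"
  by (simp add: subset_fm_def)

lemma ren_directed_fm [simp]: "ren f (directed_fm D R S) = directed_fm (f D) (f R) (f S)"
  by (simp add: directed_fm_def Let_def)

lemma ren_sup_fm [simp]: "ren f (sup_fm D R S s) = sup_fm (f D) (f R) (f S) (f s)"
  by (simp add: sup_fm_def Let_def)

lemma ren_way_below_fm [simp]:
  "ren f (way_below_fm D R x y) = way_below_fm (f D) (f R) (f x) (f y)"
  by (simp add: way_below_fm_def Let_def)

lemma ren_scott_open_fm [simp]:
  "ren f (scott_open_fm D R U) = scott_open_fm (f D) (f R) (f U)"
  by (simp add: scott_open_fm_def Let_def)

lemma ren_scott_nle_fm [simp]: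
  "ren f (scott_nle_fm D R x y) = scott_nle_fm (f D) (f R) (f x) (f y)"
  by (simp add: scott_nle_fm_def)

lemma ren_apart_fm [simp]: "ren f (apart_fm D R x y) = apart_fm (f D) (f R) (f x) (f y)"
  by (simp add: apart_fm_def)

lemma ren_sharp_fm [simp]: "ren f (sharp_fm D R x) = sharp_fm (f D) (f R) (f x)"
  by (simp add: sharp_fm_def Let_def)

text \<open>The bounds keep \<open>n - Suc p\<close> from being truncated: for \<open>p < n\<close>
  one more quantifier raises the index by exactly one, as
  \<open>Suc n - Suc p = Suc (n - Suc p)\<close>.\<close>

lemma f_upair_eq:
  "p < n \<Longrightarrow> x < n \<Longrightarrow> y < n \<Longrightarrow> f_upair p x y n = upair_fm (n - Suc p) (n - Suc x) (n - Suc y)"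
  by (simp add: f_upair_def upair_fm_def connective_defs Suc_diff_Suc)

lemma f_pair_eq:
  "p < n \<Longrightarrow> x < n \<Longrightarrow> y < n \<Longrightarrow> f_pair p x y n = pair_fm (n - Suc p) (n - Suc x) (n - Suc y)"
  by (simp add: f_pair_def pair_fm_def connective_defs f_upair_eq Suc_diff_Suc)

lemma f_le_eq:
  "R < n \<Longrightarrow> x < n \<Longrightarrow> y < n \<Longrightarrow> f_le R x y n = le_fm (n - Suc R) (n - Suc x) (n - Suc y)"
  by (simp add: f_le_def le_fm_def connective_defs f_pair_eq Suc_diff_Suc)

lemma f_subset_eq: "A < n \<Longrightarrow> B < n \<Longrightarrow> f_subset A B n = subset_fm (n - Suc A) (n - Suc B)"
  by (simp add: f_subset_def subset_fm_def connective_defs Suc_diff_Suc)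

lemma f_poset_eq: "D < n \<Longrightarrow> R < n \<Longrightarrow> f_poset D R n = poset_fm (n - Suc D) (n - Suc R)"
  by (simp add: f_poset_def poset_fm_def connective_defs f_le_eq Let_def Suc_diff_Suc Suc_diff_le)

lemma f_directed_eq:
  "D < n \<Longrightarrow> R < n \<Longrightarrow> S < n \<Longrightarrow>
    f_directed D R S n = directed_fm (n - Suc D) (n - Suc R) (n - Suc S)"
  by (simp add: f_directed_def directed_fm_def connective_defs f_le_eq f_subset_eq Let_def
      Suc_diff_Suc Suc_diff_le)

lemma f_sup_eq:
  "D < n \<Longrightarrow> R < n \<Longrightarrow> S < n \<Longrightarrow> s < n \<Longrightarrow>
    f_sup D R S s n = sup_fm (n - Suc D) (n - Suc R) (n - Suc S) (n - Suc s)"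
  by (simp add: f_sup_def sup_fm_def connective_defs f_le_eq Let_def Suc_diff_Suc Suc_diff_le)

lemma f_dcpo_eq: "D < n \<Longrightarrow> R < n \<Longrightarrow> f_dcpo D R n = dcpo_fm (n - Suc D) (n - Suc R)"
  by (simp add: f_dcpo_def dcpo_fm_def connective_defs f_poset_eq f_directed_eq f_sup_eq
      Suc_diff_Suc Suc_diff_le)

lemma f_way_below_eq:
  "D < n \<Longrightarrow> R < n \<Longrightarrow> x < n \<Longrightarrow> y < n \<Longrightarrow>
    f_way_below D R x y n = way_below_fm (n - Suc D) (n - Suc R) (n - Suc x) (n - Suc y)"
  by (simp add: f_way_below_def way_below_fm_def connective_defs f_directed_eq f_sup_eq f_le_eq
      Let_def Suc_diff_Suc Suc_diff_le)

lemma f_continuous_dcpo_eq: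
  "D < n \<Longrightarrow> R < n \<Longrightarrow>
    f_continuous_dcpo D R n = continuous_dcpo_fm (n - Suc D) (n - Suc R)"
  by (simp add: f_continuous_dcpo_def continuous_dcpo_fm_def connective_defs f_dcpo_eq
      f_way_below_eq f_directed_eq f_sup_eq Let_def Suc_diff_Suc Suc_diff_le)

lemma f_scott_open_eq:
  "D < n \<Longrightarrow> R < n \<Longrightarrow> U < n \<Longrightarrow>
    f_scott_open D R U n = scott_open_fm (n - Suc D) (n - Suc R) (n - Suc U)"
  by (simp add: f_scott_open_def scott_open_fm_def connective_defs f_subset_eq f_directed_eq
      f_sup_eq f_le_eq Let_def Suc_diff_Suc Suc_diff_le)

lemma f_scott_nle_eq:
  "D < n \<Longrightarrow> R < n \<Longrightarrow> x < n \<Longrightarrow> y < n \<Longrightarrow>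
    f_scott_nle D R x y n = scott_nle_fm (n - Suc D) (n - Suc R) (n - Suc x) (n - Suc y)"
  by (simp add: f_scott_nle_def scott_nle_fm_def connective_defs f_scott_open_eq Suc_diff_Suc)

lemma f_apart_eq:
  "D < n \<Longrightarrow> R < n \<Longrightarrow> x < n \<Longrightarrow> y < n \<Longrightarrow>
    f_apart D R x y n = apart_fm (n - Suc D) (n - Suc R) (n - Suc x) (n - Suc y)"
  by (simp add: f_apart_def apart_fm_def connective_defs f_scott_nle_eq)

lemma f_sharp_eq:
  "D < n \<Longrightarrow> R < n \<Longrightarrow> x < n \<Longrightarrow>
    f_sharp D R x n = sharp_fm (n - Suc D) (n - Suc R) (n - Suc x)"
  by (simp add: f_sharp_def sharp_fm_def connective_defs f_way_below_eq f_le_eq Let_def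
      Suc_diff_Suc Suc_diff_le)

lemmas form_eqs = f_le_eq f_continuous_dcpo_eq f_scott_nle_eq f_apart_eq f_sharp_eq

section \<open>A forcing semantics\<close>

text \<open>Derivability from \<open>D\<close> being a continuous dcpo is read as a Kripke--Beth semantics whose worlds
  are contexts ordered by inclusion and whose individuals are the variables. As contexts need not be
  prime, disjunctions and existential statements are only forced locally, i.e. on a cover.\<close>

abbreviation extends :: "fm list \<Rightarrow> fm list \<Rightarrow> bool" (infix "\<preceq>" 50) where
  "G \<preceq> H \<equiv> set G \<subseteq> set H"

context
  fixes D R :: nat
begin

definition forces :: "fm list \<Rightarrow> fm \<Rightarrow> bool" (infix "\<tturnstile>" 50) where
  "G \<tturnstile> p \<longleftrightarrow> continuous_dcpo_fm D R # G \<turnstile> p"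

text \<open>Covers are never named. That \<open>P\<close> holds on a cover is expressed by its use:
  any formula forced wherever \<open>P\<close> holds is forced already, which is the shape of the
  rules \<open>OrE\<close> and \<open>ExE\<close>. As \<open>P\<close> is a HOL predicate, it may
  quantify over witnesses.\<close>

definition locally :: "fm list \<Rightarrow> (fm list \<Rightarrow> bool) \<Rightarrow> bool" where
  "locally G P \<longleftrightarrow> (\<forall>q. (\<forall>H. G \<preceq> H \<longrightarrow> P H \<longrightarrow> H \<tturnstile> q) \<longrightarrow> G \<tturnstile> q)"

section \<open>Forcing clauses of the logical constants\<close>

lemma forces_mono: "G \<tturnstile> p \<Longrightarrow> G \<preceq> H \<Longrightarrow> H \<tturnstile> p"
  unfolding forces_def by (erule derives_weaken) auto

lemma forces_hyp: "p \<in> set G \<Longrightarrow> G \<tturnstile> p"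
  unfolding forces_def by (rule derives.Hyp) simp

lemma forces_Cons: "p # G \<tturnstile> p"
  by (rule forces_hyp) simp

lemma extends_Cons: "G \<preceq> p # G"
  by auto

lemma forces_bot: "G \<tturnstile> FBot \<Longrightarrow> G \<tturnstile> p"
  unfolding forces_def by (rule derives.BotE)

lemma forces_and: "G \<tturnstile> FAnd p q \<longleftrightarrow> G \<tturnstile> p \<and> G \<tturnstile> q"
  unfolding forces_def by (blast intro: derives.AndI derives.AndE1 derives.AndE2)

lemma forces_mp: "G \<tturnstile> FImp p q \<Longrightarrow> G \<tturnstile> p \<Longrightarrow> G \<tturnstile> q"
  unfolding forces_def by (rule derives.ImpE)

text \<open>The world \<open>p # G\<close> is generic among the extensions of \<open>G\<close> that
  force \<open>p\<close>, so what holds there can be discharged by \<open>ImpI\<close>. The converse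
  is monotonicity and modus ponens.\<close>

lemma forces_imp: "G \<tturnstile> FImp p q \<longleftrightarrow> (\<forall>H. G \<preceq> H \<longrightarrow> H \<tturnstile> p \<longrightarrow> H \<tturnstile> q)"
proof
  assume "G \<tturnstile> FImp p q"
  then show "\<forall>H. G \<preceq> H \<longrightarrow> H \<tturnstile> p \<longrightarrow> H \<tturnstile> q"
    using forces_mono forces_mp by blast
next
  assume "\<forall>H. G \<preceq> H \<longrightarrow> H \<tturnstile> p \<longrightarrow> H \<tturnstile> q"
  then have "p # G \<tturnstile> q" using forces_Cons extends_Cons by blast
  then have "p # continuous_dcpo_fm D R # G \<turnstile> q"
    unfolding forces_def by (rule derives_weaken) auto
  then show "G \<tturnstile> FImp p q" unfolding forces_def by (rule derives.ImpI)
qed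

lemma forces_iff: "G \<tturnstile> FIff p q \<Longrightarrow> G \<preceq> H \<Longrightarrow> H \<tturnstile> p \<longleftrightarrow> H \<tturnstile> q"
  by (auto simp: forces_and forces_imp)

lemma forces_iff_and:
  "G \<tturnstile> FIff p (FAnd q r) \<Longrightarrow> G \<preceq> H \<Longrightarrow> H \<tturnstile> p \<longleftrightarrow> H \<tturnstile> q \<and> H \<tturnstile> r"
  using forces_iff[of G p "FAnd q r" H] by (simp only: forces_and)

text \<open>The individuals are the variables at every world, so no extension of \<open>G\<close>
  enters; a variable fresh for \<open>G\<close> and \<open>p\<close> stands for an arbitrary
  one.\<close>

lemma forces_all: "G \<tturnstile> FAll p \<longleftrightarrow> (\<forall>x. G \<tturnstile> inst x p)"
proof
  assume "G \<tturnstile> FAll p"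
  then show "\<forall>x. G \<tturnstile> inst x p" unfolding forces_def by (blast intro: derives.AllE)
next
  assume "\<forall>x. G \<tturnstile> inst x p"
  then show "G \<tturnstile> FAll p"
    using derives_inst_fresh[of "continuous_dcpo_fm D R # G" p] derives.AllI
    unfolding forces_def by blast
qed

text \<open>One direction is \<open>ExE\<close> with a fresh variable as generic witness. For the
  other, \<open>FEx p\<close> itself is chosen as the formula forced on the cover.\<close>

lemma forces_ex: "G \<tturnstile> FEx p \<longleftrightarrow> locally G (\<lambda>H. \<exists>x. H \<tturnstile> inst x p)"
proof
  assume ex: "G \<tturnstile> FEx p"
  show "locally G (\<lambda>H. \<exists>x. H \<tturnstile> inst x p)"
    unfolding locally_def
  proof (intro allI impI)
    fix q assume q: "\<forall>H. G \<preceq> H \<longrightarrow> (\<exists>x. H \<tturnstile> inst x p) \<longrightarrow> H \<tturnstile> q"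
    have "inst x p # continuous_dcpo_fm D R # G \<turnstile> q" for x
    proof -
      have "inst x p # G \<tturnstile> q" using q forces_Cons extends_Cons by blast
      then show ?thesis unfolding forces_def by (rule derives_weaken) auto
    qed
    then show "G \<tturnstile> q"
      using ex derives_inst_fresh_hyp[of p "continuous_dcpo_fm D R # G" q] derives.ExE
      unfolding forces_def by blast
  qed
next
  assume loc: "locally G (\<lambda>H. \<exists>x. H \<tturnstile> inst x p)"
  have "H \<tturnstile> FEx p" if "\<exists>x. H \<tturnstile> inst x p" for H
    using that unfolding forces_def by (blast intro: derives.ExI)
  then show "G \<tturnstile> FEx p" using loc unfolding locally_def by blast
qed

lemma forces_or: "G \<tturnstile> FOr p q \<longleftrightarrow> locally G (\<lambda>H. H \<tturnstile> p \<or> H \<tturnstile> q)"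
proof
  assume or: "G \<tturnstile> FOr p q"
  show "locally G (\<lambda>H. H \<tturnstile> p \<or> H \<tturnstile> q)"
    unfolding locally_def
  proof (intro allI impI)
    fix s assume s: "\<forall>H. G \<preceq> H \<longrightarrow> H \<tturnstile> p \<or> H \<tturnstile> q \<longrightarrow> H \<tturnstile> s"
    then have "p # G \<tturnstile> s" "q # G \<tturnstile> s" using forces_Cons extends_Cons by blast+
    then have "p # continuous_dcpo_fm D R # G \<turnstile> s" "q # continuous_dcpo_fm D R # G \<turnstile> s"
      unfolding forces_def
      using derives_weaken[where H = "p # continuous_dcpo_fm D R # G"]
        derives_weaken[where H = "q # continuous_dcpo_fm D R # G"] by (simp_all add: insert_commute)
    with or show "G \<tturnstile> s" unfolding forces_def by (rule derives.OrE)
  qed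
next
  assume loc: "locally G (\<lambda>H. H \<tturnstile> p \<or> H \<tturnstile> q)"
  have "H \<tturnstile> FOr p q" if "H \<tturnstile> p \<or> H \<tturnstile> q" for H
    using that unfolding forces_def by (blast intro: derives.OrI1 derives.OrI2)
  then show "G \<tturnstile> FOr p q" using loc unfolding locally_def by blast
qed

section \<open>Reasoning on covers\<close>

lemma locallyI: "P G \<Longrightarrow> locally G P"
  by (simp add: locally_def)

lemma locally_forces:
  assumes "locally G P" "\<And>H. G \<preceq> H \<Longrightarrow> P H \<Longrightarrow> H \<tturnstile> q"
  shows "G \<tturnstile> q"
  using assms unfolding locally_def by blast

text \<open>Covers of the members of a cover combine to a cover. This eliminates one existential
  statement or disjunction after another inside a local goal; \<open>locally_forces\<close> does the
  same when the goal is a single formula.\<close>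

lemma locally_bind:
  assumes P: "locally G P" and Q: "\<And>H. G \<preceq> H \<Longrightarrow> P H \<Longrightarrow> locally H Q"
  shows "locally G Q"
  unfolding locally_def
proof (intro allI impI)
  fix q assume q: "\<forall>H. G \<preceq> H \<longrightarrow> Q H \<longrightarrow> H \<tturnstile> q"
  show "G \<tturnstile> q"
  proof (rule locally_forces[OF P])
    fix H assume H: "G \<preceq> H" "P H"
    have "K \<tturnstile> q" if "H \<preceq> K" "Q K" for K using q that H(1) by blast
    then show "H \<tturnstile> q" using Q[OF H] unfolding locally_def by blast
  qed
qed

lemma locally_mono: "locally G P \<Longrightarrow> (\<And>H. G \<preceq> H \<Longrightarrow> P H \<Longrightarrow> Q H) \<Longrightarrow> locally G Q"
  by (erule locally_bind) (rule locallyI)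

text \<open>Each unfolded implication introduces a further extension. By monotonicity the earlier
  hypotheses survive in the last world, so a chain of extensions collapses to one.\<close>

lemma nested_worlds:
  "(\<forall>H. G \<preceq> H \<longrightarrow> H \<tturnstile> p \<longrightarrow> (\<forall>K. H \<preceq> K \<longrightarrow> P K)) \<longleftrightarrow> (\<forall>K. G \<preceq> K \<longrightarrow> K \<tturnstile> p \<longrightarrow> P K)"
  "(\<forall>H. G \<preceq> H \<longrightarrow> H \<tturnstile> p \<longrightarrow> (\<forall>x K. H \<preceq> K \<longrightarrow> Q x K)) \<longleftrightarrow>
    (\<forall>K. G \<preceq> K \<longrightarrow> K \<tturnstile> p \<longrightarrow> (\<forall>x. Q x K))"
  by (meson forces_mono order_refl subset_trans)+

lemmas forces_simps =
  forces_and forces_imp forces_all forces_ex forces_or inst_def nested_worlds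

text \<open>The source of all sets formed below. The defining equivalence is recorded for every
  later world \<open>K\<close>, since the set is used after further facts have been assumed.\<close>

lemma separation_instance:
  "locally G (\<lambda>H. \<exists>b. \<forall>K x. H \<preceq> K \<longrightarrow>
     (K \<tturnstile> FMem x b \<longleftrightarrow> K \<tturnstile> FMem x a \<and> K \<tturnstile> inst x p))"
proof -
  have "G \<tturnstile> (\<^bold>\<forall>a. \<^bold>\<exists>b. \<^bold>\<forall>x. x \<^bold>\<in> b \<^bold>\<longleftrightarrow> x \<^bold>\<in> a \<^bold>\<and> at p [x]) 0"
    unfolding forces_def by (rule derives.Axiom) (rule IZF.separation)
  then have ax: "locally G (\<lambda>H. \<exists>b. \<forall>x. H \<tturnstile> FIff (FMem x b) (FAnd (FMem x a)
      (ren (case_nat x (\<lambda>i. i) \<circ> (lift (case_nat b (\<lambda>i. i)) \<circ> (lift (lift (case_nat a (\<lambda>i. i))) \<circ>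
        (\<lambda>i. if i = 0 then 0 else Suc (Suc (Suc (i - Suc 0))))))) p)))"
    by (simp add: connective_defs at_def inst_def forces_all forces_ex ren_ren eval_nat_numeral cong: if_cong)
  \<comment> \<open>In the axiom the parameters of \<open>p\<close> sit above three quantifiers,
    whence the threefold \<open>Suc\<close>; instantiating \<open>a\<close>, \<open>b\<close> and
    \<open>x\<close> takes this shift away again.\<close>
  have inst: "ren (case_nat x (\<lambda>i. i) \<circ> (lift (case_nat b (\<lambda>i. i)) \<circ> (lift (lift (case_nat a (\<lambda>i. i))) \<circ>
        (\<lambda>i. if i = 0 then 0 else Suc (Suc (Suc (i - Suc 0))))))) p = inst x p" for x b
    unfolding inst_def by (rule ren_eqI) (simp split: nat.split)
  from ax have "locally G (\<lambda>H. \<exists>b. \<forall>x. H \<tturnstile> FIff (FMem x b) (FAnd (FMem x a) (inst x p)))"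
    unfolding inst .
  then show ?thesis
    by (rule locally_mono) (elim exE, intro exI allI impI, rule forces_iff_and, erule spec)
qed

abbreviation below :: "nat \<Rightarrow> nat \<Rightarrow> fm" (infix "\<sqsubseteq>" 60) where
  "x \<sqsubseteq> y \<equiv> le_fm R x y"

abbreviation approximates :: "nat \<Rightarrow> nat \<Rightarrow> fm" (infix "\<lless>" 60) where
  "x \<lless> y \<equiv> way_below_fm D R x y"

abbreviation element :: "nat \<Rightarrow> nat \<Rightarrow> fm" (infix "\<epsilon>" 60) where
  "x \<epsilon> A \<equiv> FMem x A"

section \<open>Forcing the axioms of continuous dcpos\<close>

lemma forces_continuous: "G \<tturnstile> continuous_dcpo_fm D R"
  unfolding forces_def by (rule derives.Hyp) simp

lemma forces_poset: "G \<tturnstile> poset_fm D R"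
  using forces_continuous by (simp add: continuous_dcpo_fm_def dcpo_fm_def Let_def forces_and)

lemma poset_iff:
  "G \<tturnstile> poset_fm D R \<longleftrightarrow>
    (\<forall>x H. G \<preceq> H \<longrightarrow> H \<tturnstile> x \<epsilon> D \<longrightarrow> H \<tturnstile> x \<sqsubseteq> x) \<and>
    (\<forall>x H. G \<preceq> H \<longrightarrow> H \<tturnstile> x \<epsilon> D \<longrightarrow> (\<forall>y. H \<tturnstile> y \<epsilon> D \<longrightarrow> (\<forall>z. H \<tturnstile> z \<epsilon> D \<longrightarrow>
      H \<tturnstile> x \<sqsubseteq> y \<longrightarrow> H \<tturnstile> y \<sqsubseteq> z \<longrightarrow> H \<tturnstile> x \<sqsubseteq> z))) \<and>
    (\<forall>x H. G \<preceq> H \<longrightarrow> H \<tturnstile> x \<epsilon> D \<longrightarrow> (\<forall>y. H \<tturnstile> y \<epsilon> D \<longrightarrow>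
      H \<tturnstile> x \<sqsubseteq> y \<longrightarrow> H \<tturnstile> y \<sqsubseteq> x \<longrightarrow> H \<tturnstile> FEq x y))"
  by (simp add: poset_fm_def Let_def forces_simps)

lemmas poset_laws = forces_poset[unfolded poset_iff]

lemma le_refl: "G \<tturnstile> x \<epsilon> D \<Longrightarrow> G \<tturnstile> x \<sqsubseteq> x"
  using poset_laws[of G] by blast

lemma le_trans:
  "G \<tturnstile> x \<epsilon> D \<Longrightarrow> G \<tturnstile> y \<epsilon> D \<Longrightarrow> G \<tturnstile> z \<epsilon> D \<Longrightarrow> G \<tturnstile> x \<sqsubseteq> y \<Longrightarrow> G \<tturnstile> y \<sqsubseteq> z \<Longrightarrow> G \<tturnstile> x \<sqsubseteq> z"
  using poset_laws[of G] by blast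

lemma le_antisym:
  "G \<tturnstile> x \<epsilon> D \<Longrightarrow> G \<tturnstile> y \<epsilon> D \<Longrightarrow> G \<tturnstile> x \<sqsubseteq> y \<Longrightarrow> G \<tturnstile> y \<sqsubseteq> x \<Longrightarrow> G \<tturnstile> FEq x y"
  using poset_laws[of G] by blast

section \<open>The order-theoretic notions read in worlds\<close>

lemma directed_iff:
  "G \<tturnstile> directed_fm D R S \<longleftrightarrow>
    (\<forall>H x. G \<preceq> H \<longrightarrow> H \<tturnstile> x \<epsilon> S \<longrightarrow> H \<tturnstile> x \<epsilon> D) \<and>
    locally G (\<lambda>H. \<exists>x. H \<tturnstile> x \<epsilon> S) \<and>
    (\<forall>H x y. G \<preceq> H \<longrightarrow> H \<tturnstile> x \<epsilon> S \<longrightarrow> H \<tturnstile> y \<epsilon> S \<longrightarrow>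
      locally H (\<lambda>K. \<exists>z. K \<tturnstile> z \<epsilon> S \<and> K \<tturnstile> x \<sqsubseteq> z \<and> K \<tturnstile> y \<sqsubseteq> z))"
  by (simp add: directed_fm_def subset_fm_def Let_def forces_simps) blast

text \<open>That \<open>b\<close> is an upper bound occurs as a hypothesis, so it has to be read at
  all extensions \<open>K\<close> of \<open>H\<close> and not just at \<open>H\<close>.\<close>

lemma sup_iff:
  "G \<tturnstile> sup_fm D R S s \<longleftrightarrow> G \<tturnstile> s \<epsilon> D \<and>
    (\<forall>H x. G \<preceq> H \<longrightarrow> H \<tturnstile> x \<epsilon> S \<longrightarrow> H \<tturnstile> x \<sqsubseteq> s) \<and>
    (\<forall>H b. G \<preceq> H \<longrightarrow> H \<tturnstile> b \<epsilon> D \<longrightarrow> (\<forall>K x. H \<preceq> K \<longrightarrow> K \<tturnstile> x \<epsilon> S \<longrightarrow> K \<tturnstile> x \<sqsubseteq> b) \<longrightarrow>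
      H \<tturnstile> s \<sqsubseteq> b)"
  by (simp add: sup_fm_def Let_def forces_simps) blast

lemma way_below_iff:
  "G \<tturnstile> x \<lless> y \<longleftrightarrow> (\<forall>H S t. G \<preceq> H \<longrightarrow> H \<tturnstile> directed_fm D R S \<longrightarrow> H \<tturnstile> sup_fm D R S t \<longrightarrow>
    H \<tturnstile> y \<sqsubseteq> t \<longrightarrow> locally H (\<lambda>K. \<exists>s. K \<tturnstile> s \<epsilon> S \<and> K \<tturnstile> x \<sqsubseteq> s))"
  by (simp add: way_below_fm_def Let_def forces_simps) blast

lemma scott_open_iff:
  "G \<tturnstile> scott_open_fm D R U \<longleftrightarrow>
    (\<forall>H x. G \<preceq> H \<longrightarrow> H \<tturnstile> x \<epsilon> U \<longrightarrow> H \<tturnstile> x \<epsilon> D) \<and>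
    (\<forall>H x y. G \<preceq> H \<longrightarrow> H \<tturnstile> x \<epsilon> U \<longrightarrow> H \<tturnstile> y \<epsilon> D \<longrightarrow> H \<tturnstile> x \<sqsubseteq> y \<longrightarrow> H \<tturnstile> y \<epsilon> U) \<and>
    (\<forall>H S t. G \<preceq> H \<longrightarrow> H \<tturnstile> directed_fm D R S \<longrightarrow> H \<tturnstile> sup_fm D R S t \<longrightarrow> H \<tturnstile> t \<epsilon> U \<longrightarrow>
      locally H (\<lambda>K. \<exists>s. K \<tturnstile> s \<epsilon> S \<and> K \<tturnstile> s \<epsilon> U))"
  by (simp add: scott_open_fm_def subset_fm_def Let_def forces_simps) blast

lemma scott_nle_iff:
  "G \<tturnstile> scott_nle_fm D R x y \<longleftrightarrow>
    locally G (\<lambda>H. \<exists>U. H \<tturnstile> scott_open_fm D R U \<and> H \<tturnstile> x \<epsilon> U \<and> H \<tturnstile> FNot (y \<epsilon> U))"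
  by (simp add: scott_nle_fm_def forces_and forces_ex inst_def)

lemma sharp_iff:
  "G \<tturnstile> sharp_fm D R x \<longleftrightarrow> G \<tturnstile> x \<epsilon> D \<and>
    (\<forall>H u v. G \<preceq> H \<longrightarrow> H \<tturnstile> u \<epsilon> D \<longrightarrow> H \<tturnstile> v \<epsilon> D \<longrightarrow> H \<tturnstile> u \<lless> v \<longrightarrow>
      locally H (\<lambda>K. K \<tturnstile> u \<lless> x \<or> K \<tturnstile> FNot (v \<sqsubseteq> x)))"
  by (simp add: sharp_fm_def Let_def forces_simps) blast

lemma continuous_iff:
  "G \<tturnstile> continuous_dcpo_fm D R \<longleftrightarrow> G \<tturnstile> dcpo_fm D R \<and>
    (\<forall>H x. G \<preceq> H \<longrightarrow> H \<tturnstile> x \<epsilon> D \<longrightarrow>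
      locally H (\<lambda>K. \<exists>A. (\<forall>y. K \<tturnstile> FIff (y \<epsilon> A) (FAnd (y \<epsilon> D) (y \<lless> x))) \<and>
        K \<tturnstile> directed_fm D R A \<and> K \<tturnstile> sup_fm D R A x))"
  by (simp add: continuous_dcpo_fm_def Let_def forces_simps) blast

lemma approximants:
  assumes "G \<tturnstile> x \<epsilon> D"
  shows "locally G (\<lambda>H. \<exists>A. H \<tturnstile> directed_fm D R A \<and> H \<tturnstile> sup_fm D R A x \<and>
    (\<forall>K y. H \<preceq> K \<longrightarrow> (K \<tturnstile> y \<epsilon> A \<longleftrightarrow> K \<tturnstile> y \<epsilon> D \<and> K \<tturnstile> y \<lless> x)))"
proof -
  have "locally G (\<lambda>H. \<exists>A. (\<forall>y. H \<tturnstile> FIff (y \<epsilon> A) (FAnd (y \<epsilon> D) (y \<lless> x))) \<and>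
    H \<tturnstile> directed_fm D R A \<and> H \<tturnstile> sup_fm D R A x)"
    using forces_continuous[of G] assms unfolding continuous_iff by blast
  then show ?thesis
    by (rule locally_mono)
      (elim exE conjE, intro exI conjI allI impI, assumption+, rule forces_iff_and, erule spec)
qed

section \<open>The way-below relation\<close>

lemma directed_mem: "G \<tturnstile> directed_fm D R S \<Longrightarrow> G \<tturnstile> x \<epsilon> S \<Longrightarrow> G \<tturnstile> x \<epsilon> D"
  unfolding directed_iff by blast

lemma sup_mem: "G \<tturnstile> sup_fm D R S s \<Longrightarrow> G \<tturnstile> s \<epsilon> D"
  unfolding sup_iff by blast

lemma sup_upper: "G \<tturnstile> sup_fm D R S s \<Longrightarrow> G \<tturnstile> x \<epsilon> S \<Longrightarrow> G \<tturnstile> x \<sqsubseteq> s"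
  unfolding sup_iff by blast

lemma sup_least:
  assumes "G \<tturnstile> sup_fm D R S s" "G \<tturnstile> b \<epsilon> D" "\<And>H x. G \<preceq> H \<Longrightarrow> H \<tturnstile> x \<epsilon> S \<Longrightarrow> H \<tturnstile> x \<sqsubseteq> b"
  shows "G \<tturnstile> s \<sqsubseteq> b"
  using assms unfolding sup_iff by blast

lemma way_below_dest:
  "G \<tturnstile> x \<lless> y \<Longrightarrow> G \<tturnstile> directed_fm D R S \<Longrightarrow> G \<tturnstile> sup_fm D R S t \<Longrightarrow> G \<tturnstile> y \<sqsubseteq> t \<Longrightarrow>
    locally G (\<lambda>H. \<exists>s. H \<tturnstile> s \<epsilon> S \<and> H \<tturnstile> x \<sqsubseteq> s)"
  unfolding way_below_iff by blast

text \<open>Reduces an inequality to the approximants of its left-hand side. In \<open>ub\<close>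
  the world varies along with \<open>v\<close>, because \<open>v\<close> is a generic approximant
  about which new facts are assumed.\<close>

lemma approximants_least:
  assumes x: "G \<tturnstile> x \<epsilon> D" and b: "G \<tturnstile> b \<epsilon> D"
    and ub: "\<And>H v. G \<preceq> H \<Longrightarrow> H \<tturnstile> v \<epsilon> D \<Longrightarrow> H \<tturnstile> v \<lless> x \<Longrightarrow> H \<tturnstile> v \<sqsubseteq> b"
  shows "G \<tturnstile> x \<sqsubseteq> b"
proof (rule locally_forces[OF approximants[OF x]], elim exE conjE)
  fix H A
  assume GH: "G \<preceq> H" and sup: "H \<tturnstile> sup_fm D R A x"
    and A: "\<forall>K y. H \<preceq> K \<longrightarrow> (K \<tturnstile> y \<epsilon> A \<longleftrightarrow> K \<tturnstile> y \<epsilon> D \<and> K \<tturnstile> y \<lless> x)"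
  show "H \<tturnstile> x \<sqsubseteq> b"
    using sup forces_mono[OF b GH]
  proof (rule sup_least)
    fix K v assume "H \<preceq> K" "K \<tturnstile> v \<epsilon> A"
    then show "K \<tturnstile> v \<sqsubseteq> b" using A ub[of K v] GH by blast
  qed
qed

lemma approximants_inhabited:
  assumes "G \<tturnstile> x \<epsilon> D"
  shows "locally G (\<lambda>H. \<exists>v. H \<tturnstile> v \<epsilon> D \<and> H \<tturnstile> v \<lless> x)"
proof (rule locally_bind[OF approximants[OF assms]], elim exE conjE)
  fix H A
  assume dir: "H \<tturnstile> directed_fm D R A"
    and A: "\<forall>K y. H \<preceq> K \<longrightarrow> (K \<tturnstile> y \<epsilon> A \<longleftrightarrow> K \<tturnstile> y \<epsilon> D \<and> K \<tturnstile> y \<lless> x)"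
  have "locally H (\<lambda>K. \<exists>v. K \<tturnstile> v \<epsilon> A)" using dir unfolding directed_iff by blast
  then show "locally H (\<lambda>K. \<exists>v. K \<tturnstile> v \<epsilon> D \<and> K \<tturnstile> v \<lless> x)"
    by (rule locally_mono) (use A in blast)
qed

lemma approximants_directed:
  assumes x: "G \<tturnstile> x \<epsilon> D" and u: "G \<tturnstile> u \<epsilon> D" "G \<tturnstile> u \<lless> x" and v: "G \<tturnstile> v \<epsilon> D" "G \<tturnstile> v \<lless> x"
  shows "locally G (\<lambda>H. \<exists>w. H \<tturnstile> w \<epsilon> D \<and> H \<tturnstile> w \<lless> x \<and> H \<tturnstile> u \<sqsubseteq> w \<and> H \<tturnstile> v \<sqsubseteq> w)"
proof (rule locally_bind[OF approximants[OF x]], elim exE conjE)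
  fix H A
  assume GH: "G \<preceq> H" and dir: "H \<tturnstile> directed_fm D R A"
    and A: "\<forall>K y. H \<preceq> K \<longrightarrow> (K \<tturnstile> y \<epsilon> A \<longleftrightarrow> K \<tturnstile> y \<epsilon> D \<and> K \<tturnstile> y \<lless> x)"
  have "H \<tturnstile> u \<epsilon> A" "H \<tturnstile> v \<epsilon> A"
    using A u[THEN forces_mono, OF GH] v[THEN forces_mono, OF GH] by blast+
  with dir have "locally H (\<lambda>K. \<exists>w. K \<tturnstile> w \<epsilon> A \<and> K \<tturnstile> u \<sqsubseteq> w \<and> K \<tturnstile> v \<sqsubseteq> w)"
    unfolding directed_iff by blast
  then show "locally H (\<lambda>K. \<exists>w. K \<tturnstile> w \<epsilon> D \<and> K \<tturnstile> w \<lless> x \<and> K \<tturnstile> u \<sqsubseteq> w \<and> K \<tturnstile> v \<sqsubseteq> w)"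
    by (rule locally_mono) (use A in blast)
qed

text \<open>The approximants of \<open>y\<close> serve as directed set with supremum
  \<open>y\<close>: one of them lies above \<open>x\<close>, and all lie below \<open>y\<close>.
  Continuity provides this set, whereas the singleton of \<open>y\<close> would have to be formed
  first.\<close>

lemma way_below_imp_le:
  assumes x: "G \<tturnstile> x \<epsilon> D" and y: "G \<tturnstile> y \<epsilon> D" and xy: "G \<tturnstile> x \<lless> y"
  shows "G \<tturnstile> x \<sqsubseteq> y"
proof (rule locally_forces[OF approximants[OF y]], elim exE conjE)
  fix H A
  assume GH: "G \<preceq> H" and dir: "H \<tturnstile> directed_fm D R A" and sup: "H \<tturnstile> sup_fm D R A y"
  have "locally H (\<lambda>K. \<exists>s. K \<tturnstile> s \<epsilon> A \<and> K \<tturnstile> x \<sqsubseteq> s)"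
    using way_below_dest[OF forces_mono[OF xy GH] dir sup le_refl[OF forces_mono[OF y GH]]] .
  then show "H \<tturnstile> x \<sqsubseteq> y"
  proof (rule locally_forces, elim exE conjE)
    fix K s assume HK: "H \<preceq> K" and s: "K \<tturnstile> s \<epsilon> A" "K \<tturnstile> x \<sqsubseteq> s"
    have GK: "G \<preceq> K" using GH HK by blast
    show "K \<tturnstile> x \<sqsubseteq> y"
      using forces_mono[OF x GK] directed_mem[OF forces_mono[OF dir HK] s(1)] forces_mono[OF y GK]
        s(2) sup_upper[OF forces_mono[OF sup HK] s(1)] by (rule le_trans)
  qed
qed

lemma way_below_le_trans:
  assumes "G \<tturnstile> y \<epsilon> D" "G \<tturnstile> z \<epsilon> D" "G \<tturnstile> x \<lless> y" "G \<tturnstile> y \<sqsubseteq> z"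
  shows "G \<tturnstile> x \<lless> z"
  unfolding way_below_iff
proof (intro allI impI)
  fix H S t
  assume GH: "G \<preceq> H" and S: "H \<tturnstile> directed_fm D R S" "H \<tturnstile> sup_fm D R S t" and zt: "H \<tturnstile> z \<sqsubseteq> t"
  note H = assms[THEN forces_mono, OF GH]
  have "H \<tturnstile> y \<sqsubseteq> t" using H(1,2) sup_mem[OF S(2)] H(4) zt by (rule le_trans)
  with H(3) S show "locally H (\<lambda>K. \<exists>s. K \<tturnstile> s \<epsilon> S \<and> K \<tturnstile> x \<sqsubseteq> s)" by (rule way_below_dest)
qed

lemma le_way_below_trans:
  assumes "G \<tturnstile> x \<epsilon> D" "G \<tturnstile> y \<epsilon> D" "G \<tturnstile> x \<sqsubseteq> y" "G \<tturnstile> y \<lless> z"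
  shows "G \<tturnstile> x \<lless> z"
  unfolding way_below_iff
proof (intro allI impI)
  fix H S t
  assume GH: "G \<preceq> H" and S: "H \<tturnstile> directed_fm D R S" "H \<tturnstile> sup_fm D R S t" and zt: "H \<tturnstile> z \<sqsubseteq> t"
  have "locally H (\<lambda>K. \<exists>s. K \<tturnstile> s \<epsilon> S \<and> K \<tturnstile> y \<sqsubseteq> s)"
    using forces_mono[OF assms(4) GH] S zt by (rule way_below_dest)
  then show "locally H (\<lambda>K. \<exists>s. K \<tturnstile> s \<epsilon> S \<and> K \<tturnstile> x \<sqsubseteq> s)"
  proof (rule locally_mono, elim exE conjE)
    fix K s assume HK: "H \<preceq> K" and s: "K \<tturnstile> s \<epsilon> S" "K \<tturnstile> y \<sqsubseteq> s"
    have GK: "G \<preceq> K" using GH HK by blast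
    note K = assms[THEN forces_mono, OF GK]
    have "K \<tturnstile> x \<sqsubseteq> s"
      using K(1,2) directed_mem[OF forces_mono[OF S(1) HK] s(1)] K(3) s(2) by (rule le_trans)
    with s(1) show "\<exists>s. K \<tturnstile> s \<epsilon> S \<and> K \<tturnstile> x \<sqsubseteq> s" by blast
  qed
qed

text \<open>Interpolation: the elements \<open>w \<lless> v \<lless> t\<close> form a directed set with supremum \<open>t\<close>.\<close>

lemma interpolation:
  assumes u: "G \<tturnstile> u \<epsilon> D" and t: "G \<tturnstile> t \<epsilon> D" and ut: "G \<tturnstile> u \<lless> t"
  shows "locally G (\<lambda>H. \<exists>v. H \<tturnstile> v \<epsilon> D \<and> H \<tturnstile> u \<lless> v \<and> H \<tturnstile> v \<lless> t)"
proof -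
  let ?D2 = "Suc (Suc D)" and ?R2 = "Suc (Suc R)"
  \<comment> \<open>In the scope of \<open>FEx\<close>, index 0 is the interpolating
    \<open>v\<close> and index 1 the element \<open>w\<close> being separated; the parameters
    \<open>D\<close>, \<open>R\<close>, \<open>t\<close> are therefore shifted by two.\<close>
  define p where "p = FEx (FAnd (FMem 0 ?D2)
    (FAnd (way_below_fm ?D2 ?R2 (Suc 0) 0) (way_below_fm ?D2 ?R2 0 (Suc (Suc t)))))"
  have p: "K \<tturnstile> inst w p \<longleftrightarrow> locally K (\<lambda>L. \<exists>v. L \<tturnstile> v \<epsilon> D \<and> L \<tturnstile> w \<lless> v \<and> L \<tturnstile> v \<lless> t)" for K w
    by (simp add: p_def forces_simps)
  show ?thesis
  proof (rule locally_bind[OF separation_instance[of G D p]], elim exE)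
    fix H S assume GH: "G \<preceq> H"
      and "\<forall>K w. H \<preceq> K \<longrightarrow> (K \<tturnstile> w \<epsilon> S \<longleftrightarrow> K \<tturnstile> w \<epsilon> D \<and> K \<tturnstile> inst w p)"
    then have S: "K \<tturnstile> w \<epsilon> S \<longleftrightarrow> K \<tturnstile> w \<epsilon> D \<and>
        locally K (\<lambda>L. \<exists>v. L \<tturnstile> v \<epsilon> D \<and> L \<tturnstile> w \<lless> v \<and> L \<tturnstile> v \<lless> t)" if "H \<preceq> K" for K w
      using that unfolding p by blast
    have SI: "K \<tturnstile> w \<epsilon> S"
      if "H \<preceq> K" "K \<tturnstile> w \<epsilon> D" "K \<tturnstile> v \<epsilon> D" "K \<tturnstile> w \<lless> v" "K \<tturnstile> v \<lless> t" for K w v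
      unfolding S[OF that(1)] using that by (blast intro: locallyI)
    have inh: "locally H (\<lambda>K. \<exists>w. K \<tturnstile> w \<epsilon> S)"
    proof (rule locally_bind[OF approximants_inhabited[OF forces_mono[OF t GH]]], elim exE conjE)
      fix K v assume HK: "H \<preceq> K" and v: "K \<tturnstile> v \<epsilon> D" "K \<tturnstile> v \<lless> t"
      show "locally K (\<lambda>L. \<exists>w. L \<tturnstile> w \<epsilon> S)"
      proof (rule locally_mono[OF approximants_inhabited[OF v(1)]], elim exE conjE)
        fix L w assume KL: "K \<preceq> L" and w: "L \<tturnstile> w \<epsilon> D" "L \<tturnstile> w \<lless> v"
        show "\<exists>w. L \<tturnstile> w \<epsilon> S"
          using SI[OF _ w(1) forces_mono[OF v(1) KL] w(2) forces_mono[OF v(2) KL]] HK KL by blast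
      qed
    qed
    \<comment> \<open>Directedness is used at two levels. Given
      \<open>x \<lless> a \<lless> t\<close> and \<open>y \<lless> b \<lless> t\<close>, some
      \<open>c \<lless> t\<close> lies above \<open>a\<close> and \<open>b\<close>; then
      \<open>x\<close> and \<open>y\<close> approximate \<open>c\<close>, and some
      \<open>z \<lless> c\<close> lies above both.\<close>
    have dir: "locally K (\<lambda>L. \<exists>z. L \<tturnstile> z \<epsilon> S \<and> L \<tturnstile> x \<sqsubseteq> z \<and> L \<tturnstile> y \<sqsubseteq> z)"
      if HK: "H \<preceq> K" and x: "K \<tturnstile> x \<epsilon> S" and y: "K \<tturnstile> y \<epsilon> S" for K x y
    proof -
      have GK: "G \<preceq> K" using GH HK by blast
      have xD: "K \<tturnstile> x \<epsilon> D" and yD: "K \<tturnstile> y \<epsilon> D"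
        and x': "locally K (\<lambda>L. \<exists>v. L \<tturnstile> v \<epsilon> D \<and> L \<tturnstile> x \<lless> v \<and> L \<tturnstile> v \<lless> t)"
        using x y S[OF HK] by blast+
      show ?thesis
      proof (rule locally_bind[OF x'], elim exE conjE)
        fix L a assume KL: "K \<preceq> L" and a: "L \<tturnstile> a \<epsilon> D" "L \<tturnstile> x \<lless> a" "L \<tturnstile> a \<lless> t"
        have HL: "H \<preceq> L" using HK KL by blast
        have y': "locally L (\<lambda>M. \<exists>v. M \<tturnstile> v \<epsilon> D \<and> M \<tturnstile> y \<lless> v \<and> M \<tturnstile> v \<lless> t)"
          using forces_mono[OF y KL] S[OF HL] by blast
        show "locally L (\<lambda>L. \<exists>z. L \<tturnstile> z \<epsilon> S \<and> L \<tturnstile> x \<sqsubseteq> z \<and> L \<tturnstile> y \<sqsubseteq> z)"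
        proof (rule locally_bind[OF y'], elim exE conjE)
          fix M b assume LM: "L \<preceq> M" and b: "M \<tturnstile> b \<epsilon> D" "M \<tturnstile> y \<lless> b" "M \<tturnstile> b \<lless> t"
          note aM = a[THEN forces_mono, OF LM]
          have GM: "G \<preceq> M" using GK KL LM by blast
          show "locally M (\<lambda>L. \<exists>z. L \<tturnstile> z \<epsilon> S \<and> L \<tturnstile> x \<sqsubseteq> z \<and> L \<tturnstile> y \<sqsubseteq> z)"
          proof (rule locally_bind[OF approximants_directed[OF forces_mono[OF t GM]
                  aM(1,3) b(1,3)]], elim exE conjE)
            fix N c assume MN: "M \<preceq> N" and c: "N \<tturnstile> c \<epsilon> D" "N \<tturnstile> c \<lless> t"
              and le: "N \<tturnstile> a \<sqsubseteq> c" "N \<tturnstile> b \<sqsubseteq> c"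
            note aN = aM[THEN forces_mono, OF MN] and bN = b[THEN forces_mono, OF MN]
            have KN: "K \<preceq> N" using KL LM MN by blast
            have xN: "N \<tturnstile> x \<epsilon> D" and yN: "N \<tturnstile> y \<epsilon> D" using xD yD KN by (blast intro: forces_mono)+
            have "N \<tturnstile> x \<lless> c" using aN(1) c(1) aN(2) le(1) by (rule way_below_le_trans)
            moreover have "N \<tturnstile> y \<lless> c" using bN(1) c(1) bN(2) le(2) by (rule way_below_le_trans)
            ultimately have "locally N (\<lambda>P. \<exists>z. P \<tturnstile> z \<epsilon> D \<and> P \<tturnstile> z \<lless> c \<and> P \<tturnstile> x \<sqsubseteq> z \<and> P \<tturnstile> y \<sqsubseteq> z)"
              using approximants_directed[OF c(1)] xN yN by blast
            then show "locally N (\<lambda>L. \<exists>z. L \<tturnstile> z \<epsilon> S \<and> L \<tturnstile> x \<sqsubseteq> z \<and> L \<tturnstile> y \<sqsubseteq> z)"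
            proof (rule locally_mono, elim exE conjE)
              fix P z assume NP: "N \<preceq> P" and z: "P \<tturnstile> z \<epsilon> D" "P \<tturnstile> z \<lless> c" "P \<tturnstile> x \<sqsubseteq> z" "P \<tturnstile> y \<sqsubseteq> z"
              have "P \<tturnstile> z \<epsilon> S"
                using SI[OF _ z(1) forces_mono[OF c(1) NP] z(2) forces_mono[OF c(2) NP]]
                  HK KN NP by blast
              with z show "\<exists>z. P \<tturnstile> z \<epsilon> S \<and> P \<tturnstile> x \<sqsubseteq> z \<and> P \<tturnstile> y \<sqsubseteq> z" by blast
            qed
          qed
        qed
      qed
    qed
    have upper: "K \<tturnstile> w \<sqsubseteq> t" if HK: "H \<preceq> K" and w: "K \<tturnstile> w \<epsilon> S" for K w
    proof -
      have wD: "K \<tturnstile> w \<epsilon> D" and loc: "locally K (\<lambda>L. \<exists>v. L \<tturnstile> v \<epsilon> D \<and> L \<tturnstile> w \<lless> v \<and> L \<tturnstile> v \<lless> t)"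
        using w S[OF HK] by blast+
      show ?thesis
      proof (rule locally_forces[OF loc], elim exE conjE)
        fix L v assume KL: "K \<preceq> L" and v: "L \<tturnstile> v \<epsilon> D" "L \<tturnstile> w \<lless> v" "L \<tturnstile> v \<lless> t"
        have wL: "L \<tturnstile> w \<epsilon> D" and tL: "L \<tturnstile> t \<epsilon> D"
          using wD t GH HK KL by (blast intro: forces_mono)+
        show "L \<tturnstile> w \<sqsubseteq> t"
          using wL v(1) tL way_below_imp_le[OF wL v(1,2)] way_below_imp_le[OF v(1) tL v(3)]
          by (rule le_trans)
      qed
    qed
    \<comment> \<open>An upper bound \<open>b\<close> of \<open>S\<close> lies above every
      \<open>w \<lless> v\<close> whenever \<open>v \<lless> t\<close>, hence above every such
      \<open>v\<close>, hence above \<open>t\<close>.\<close>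
    have least: "K \<tturnstile> t \<sqsubseteq> b"
      if HK: "H \<preceq> K" and b: "K \<tturnstile> b \<epsilon> D" and ub: "\<forall>L w. K \<preceq> L \<longrightarrow> L \<tturnstile> w \<epsilon> S \<longrightarrow> L \<tturnstile> w \<sqsubseteq> b" for K b
    proof (rule approximants_least)
      show "K \<tturnstile> t \<epsilon> D" using t GH HK by (blast intro: forces_mono)
      show "K \<tturnstile> b \<epsilon> D" by (fact b)
      fix L v assume KL: "K \<preceq> L" and v: "L \<tturnstile> v \<epsilon> D" "L \<tturnstile> v \<lless> t"
      show "L \<tturnstile> v \<sqsubseteq> b"
      proof (rule approximants_least[OF v(1) forces_mono[OF b KL]])
        fix M w assume LM: "L \<preceq> M" and w: "M \<tturnstile> w \<epsilon> D" "M \<tturnstile> w \<lless> v"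
        have "M \<tturnstile> w \<epsilon> S"
          using SI[OF _ w(1) forces_mono[OF v(1) LM] w(2) forces_mono[OF v(2) LM]] HK KL LM by blast
        then show "M \<tturnstile> w \<sqsubseteq> b" using ub KL LM by blast
      qed
    qed
    have "H \<tturnstile> directed_fm D R S"
      unfolding directed_iff using inh dir S by blast
    moreover have "H \<tturnstile> sup_fm D R S t"
      unfolding sup_iff using forces_mono[OF t GH] upper least by blast
    \<comment> \<open>Applying \<open>u \<lless> t\<close> to \<open>S\<close> gives
      \<open>u \<sqsubseteq> s\<close> for some \<open>s\<close> in \<open>S\<close>; the
      \<open>v\<close> with \<open>s \<lless> v \<lless> t\<close> that witnesses membership then
      interpolates.\<close>
    ultimately have "locally H (\<lambda>K. \<exists>s. K \<tturnstile> s \<epsilon> S \<and> K \<tturnstile> u \<sqsubseteq> s)"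
      using way_below_dest[OF forces_mono[OF ut GH] _ _ le_refl[OF forces_mono[OF t GH]]] by blast
    then show "locally H (\<lambda>K. \<exists>v. K \<tturnstile> v \<epsilon> D \<and> K \<tturnstile> u \<lless> v \<and> K \<tturnstile> v \<lless> t)"
    proof (rule locally_bind, elim exE conjE)
      fix K s assume HK: "H \<preceq> K" and s: "K \<tturnstile> s \<epsilon> S" and us: "K \<tturnstile> u \<sqsubseteq> s"
      have sD: "K \<tturnstile> s \<epsilon> D" and loc: "locally K (\<lambda>L. \<exists>v. L \<tturnstile> v \<epsilon> D \<and> L \<tturnstile> s \<lless> v \<and> L \<tturnstile> v \<lless> t)"
        using s S[OF HK] by blast+
      show "locally K (\<lambda>K. \<exists>v. K \<tturnstile> v \<epsilon> D \<and> K \<tturnstile> u \<lless> v \<and> K \<tturnstile> v \<lless> t)"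
      proof (rule locally_mono[OF loc], elim exE conjE)
        fix L v assume KL: "K \<preceq> L" and v: "L \<tturnstile> v \<epsilon> D" "L \<tturnstile> s \<lless> v" "L \<tturnstile> v \<lless> t"
        have uL: "L \<tturnstile> u \<epsilon> D" using u GH HK KL by (blast intro: forces_mono)
        have "L \<tturnstile> u \<lless> v"
          using uL forces_mono[OF sD KL] forces_mono[OF us KL] v(2) by (rule le_way_below_trans)
        with v show "\<exists>v. L \<tturnstile> v \<epsilon> D \<and> L \<tturnstile> u \<lless> v \<and> L \<tturnstile> v \<lless> t" by blast
      qed
    qed
  qed
qed

text \<open>If \<open>u \<lless> t\<close> and \<open>t\<close> is the supremum of \<open>S\<close>,
  interpolation gives \<open>u \<lless> v \<lless> t\<close>; some \<open>s\<close> in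
  \<open>S\<close> lies above \<open>v\<close>, so \<open>u \<lless> s\<close>.\<close>

lemma way_above_scott_open:
  assumes u: "G \<tturnstile> u \<epsilon> D"
  shows "locally G (\<lambda>H. \<exists>U. H \<tturnstile> scott_open_fm D R U \<and>
    (\<forall>K x. H \<preceq> K \<longrightarrow> (K \<tturnstile> x \<epsilon> U \<longleftrightarrow> K \<tturnstile> x \<epsilon> D \<and> K \<tturnstile> u \<lless> x)))"
proof -
  define p where "p = way_below_fm (Suc D) (Suc R) (Suc u) 0"
  have p: "inst x p = u \<lless> x" for x by (simp add: p_def inst_def)
  show ?thesis
  proof (rule locally_mono[OF separation_instance[of G D p]], elim exE)
    fix H U assume GH: "G \<preceq> H"
      and "\<forall>K x. H \<preceq> K \<longrightarrow> (K \<tturnstile> x \<epsilon> U \<longleftrightarrow> K \<tturnstile> x \<epsilon> D \<and> K \<tturnstile> inst x p)"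
    then have U: "\<forall>K x. H \<preceq> K \<longrightarrow> (K \<tturnstile> x \<epsilon> U \<longleftrightarrow> K \<tturnstile> x \<epsilon> D \<and> K \<tturnstile> u \<lless> x)"
      unfolding p by blast
    have "locally K (\<lambda>L. \<exists>s. L \<tturnstile> s \<epsilon> S \<and> L \<tturnstile> s \<epsilon> U)"
      if HK: "H \<preceq> K" and dir: "K \<tturnstile> directed_fm D R S" and sup: "K \<tturnstile> sup_fm D R S t"
        and t: "K \<tturnstile> t \<epsilon> U" for K S t
    proof -
      have GK: "G \<preceq> K" using GH HK by blast
      have tD: "K \<tturnstile> t \<epsilon> D" and ut: "K \<tturnstile> u \<lless> t" using t HK U by blast+
      show ?thesis
      proof (rule locally_bind[OF interpolation[OF forces_mono[OF u GK] tD ut]], elim exE conjE)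
        fix L v assume KL: "K \<preceq> L" and v: "L \<tturnstile> v \<epsilon> D" "L \<tturnstile> u \<lless> v" "L \<tturnstile> v \<lless> t"
        have "locally L (\<lambda>M. \<exists>s. M \<tturnstile> s \<epsilon> S \<and> M \<tturnstile> v \<sqsubseteq> s)"
          using v(3) forces_mono[OF dir KL] forces_mono[OF sup KL] le_refl[OF forces_mono[OF tD KL]]
          by (rule way_below_dest)
        then show "locally L (\<lambda>L. \<exists>s. L \<tturnstile> s \<epsilon> S \<and> L \<tturnstile> s \<epsilon> U)"
        proof (rule locally_mono, elim exE conjE)
          fix M s assume LM: "L \<preceq> M" and s: "M \<tturnstile> s \<epsilon> S" "M \<tturnstile> v \<sqsubseteq> s"
          have KM: "K \<preceq> M" using KL LM by blast
          have sD: "M \<tturnstile> s \<epsilon> D" using forces_mono[OF dir KM] s(1) by (rule directed_mem)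
          have "M \<tturnstile> u \<lless> s"
            using forces_mono[OF v(1) LM] sD forces_mono[OF v(2) LM] s(2) by (rule way_below_le_trans)
          then have "M \<tturnstile> s \<epsilon> U" using U HK KM sD by blast
          with s(1) show "\<exists>s. M \<tturnstile> s \<epsilon> S \<and> M \<tturnstile> s \<epsilon> U" by blast
        qed
      qed
    qed
    moreover have "K \<tturnstile> y \<epsilon> U" if "H \<preceq> K" "K \<tturnstile> x \<epsilon> U" "K \<tturnstile> y \<epsilon> D" "K \<tturnstile> x \<sqsubseteq> y" for K x y
      using that U way_below_le_trans[of K x y u] by blast
    ultimately have "H \<tturnstile> scott_open_fm D R U" unfolding scott_open_iff using U by blast
    with U show "\<exists>U. H \<tturnstile> scott_open_fm D R U \<and>
      (\<forall>K x. H \<preceq> K \<longrightarrow> (K \<tturnstile> x \<epsilon> U \<longleftrightarrow> K \<tturnstile> x \<epsilon> D \<and> K \<tturnstile> u \<lless> x))" by blast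
  qed
qed

section \<open>Apartness from sharp elements\<close>

lemma scott_nleI:
  assumes v: "G \<tturnstile> v \<epsilon> D" and x: "G \<tturnstile> x \<epsilon> D" and vx: "G \<tturnstile> v \<lless> x" and nle: "G \<tturnstile> FNot (v \<sqsubseteq> y)"
  shows "G \<tturnstile> scott_nle_fm D R x y"
  unfolding scott_nle_iff
proof (rule locally_mono[OF way_above_scott_open[OF v]], elim exE conjE)
  fix H U assume GH: "G \<preceq> H" and op: "H \<tturnstile> scott_open_fm D R U"
    and U: "\<forall>K x. H \<preceq> K \<longrightarrow> (K \<tturnstile> x \<epsilon> U \<longleftrightarrow> K \<tturnstile> x \<epsilon> D \<and> K \<tturnstile> v \<lless> x)"
  have "H \<tturnstile> x \<epsilon> U" using U forces_mono[OF x GH] forces_mono[OF vx GH] by blast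
  moreover have "H \<tturnstile> FNot (y \<epsilon> U)"
    unfolding forces_imp
  proof (intro allI impI)
    fix K assume HK: "H \<preceq> K" and "K \<tturnstile> y \<epsilon> U"
    then have y: "K \<tturnstile> y \<epsilon> D" "K \<tturnstile> v \<lless> y" using U by blast+
    have GK: "G \<preceq> K" using GH HK by blast
    have "K \<tturnstile> v \<sqsubseteq> y" using forces_mono[OF v GK] y by (rule way_below_imp_le)
    with forces_mono[OF nle GK] show "K \<tturnstile> FBot" by (rule forces_mp)
  qed
  ultimately show "\<exists>U. H \<tturnstile> scott_open_fm D R U \<and> H \<tturnstile> x \<epsilon> U \<and> H \<tturnstile> FNot (y \<epsilon> U)" using op by blast
qed

section \<open>Tightness\<close>

lemma sharp_dest:
  "G \<tturnstile> sharp_fm D R x \<Longrightarrow> G \<tturnstile> u \<epsilon> D \<Longrightarrow> G \<tturnstile> v \<epsilon> D \<Longrightarrow> G \<tturnstile> u \<lless> v \<Longrightarrow>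
    locally G (\<lambda>H. H \<tturnstile> u \<lless> x \<or> H \<tturnstile> FNot (v \<sqsubseteq> x))"
  unfolding sharp_iff by blast

lemma sharp_mem: "G \<tturnstile> sharp_fm D R x \<Longrightarrow> G \<tturnstile> x \<epsilon> D"
  unfolding sharp_iff by blast

text \<open>Sharpness does not decide \<open>v \<sqsubseteq> y\<close>: its positive side only
  speaks of a \<open>u \<lless> v\<close>. Hence \<open>approximants_least\<close> is applied twice,
  first to \<open>x\<close> and then to \<open>v\<close>. On the negative side
  \<open>scott_nleI\<close> contradicts the assumption, and the inconsistent world forces the
  goal.\<close>

lemma sharp_le:
  assumes sharp: "G \<tturnstile> sharp_fm D R y" and x: "G \<tturnstile> x \<epsilon> D" and not: "G \<tturnstile> FNot (scott_nle_fm D R x y)"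
  shows "G \<tturnstile> x \<sqsubseteq> y"
proof (rule approximants_least[OF x sharp_mem[OF sharp]])
  fix H v assume GH: "G \<preceq> H" and v: "H \<tturnstile> v \<epsilon> D" "H \<tturnstile> v \<lless> x"
  show "H \<tturnstile> v \<sqsubseteq> y"
  proof (rule approximants_least[OF v(1) forces_mono[OF sharp_mem[OF sharp] GH]])
    fix K u assume HK: "H \<preceq> K" and u: "K \<tturnstile> u \<epsilon> D" "K \<tturnstile> u \<lless> v"
    have GK: "G \<preceq> K" using GH HK by blast
    note vK = v[THEN forces_mono, OF HK]
    show "K \<tturnstile> u \<sqsubseteq> y"
    proof (rule locally_forces[OF sharp_dest[OF forces_mono[OF sharp GK] u(1) vK(1) u(2)]],
        elim disjE)
      fix L assume KL: "K \<preceq> L" and "L \<tturnstile> u \<lless> y"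
      then show "L \<tturnstile> u \<sqsubseteq> y"
        using forces_mono[OF u(1) KL] sharp_mem[OF sharp] GK by (blast intro: forces_mono way_below_imp_le)
    next
      fix L assume KL: "K \<preceq> L" and "L \<tturnstile> FNot (v \<sqsubseteq> y)"
      moreover have GL: "G \<preceq> L" using GK KL by blast
      ultimately have "L \<tturnstile> scott_nle_fm D R x y"
        using vK[THEN forces_mono, OF KL] forces_mono[OF x GL] by (blast intro: scott_nleI)
      with forces_mono[OF not GL] have "L \<tturnstile> FBot" by (rule forces_mp)
      then show "L \<tturnstile> u \<sqsubseteq> y" by (rule forces_bot)
    qed
  qed
qed

lemma apart_sym: "G \<tturnstile> apart_fm D R x y \<Longrightarrow> G \<tturnstile> apart_fm D R y x"
  unfolding apart_fm_def forces_or by (erule locally_mono) blast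

lemma scott_nle_apart: "G \<tturnstile> scott_nle_fm D R x y \<Longrightarrow> G \<tturnstile> apart_fm D R x y"
  unfolding apart_fm_def forces_or by (blast intro: locallyI)

lemma sharp_tight:
  assumes x: "G \<tturnstile> sharp_fm D R x" and y: "G \<tturnstile> sharp_fm D R y" and not: "G \<tturnstile> FNot (apart_fm D R x y)"
  shows "G \<tturnstile> FEq x y"
proof (rule le_antisym)
  show "G \<tturnstile> x \<epsilon> D" "G \<tturnstile> y \<epsilon> D" using sharp_mem x y by blast+
  have "G \<tturnstile> FNot (scott_nle_fm D R x y)" "G \<tturnstile> FNot (scott_nle_fm D R y x)"
    using not scott_nle_apart apart_sym unfolding forces_imp by blast+
  \<comment> \<open>Each inequality rests on the sharpness of its right-hand side.\<close>
  then show "G \<tturnstile> x \<sqsubseteq> y" "G \<tturnstile> y \<sqsubseteq> x" using x y by (blast intro: sharp_le sharp_mem)+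
qed

section \<open>Cotransitivity at sharp elements\<close>

lemma scott_open_approximant:
  assumes op: "G \<tturnstile> scott_open_fm D R U" and x: "G \<tturnstile> x \<epsilon> D" "G \<tturnstile> x \<epsilon> U"
  shows "locally G (\<lambda>H. \<exists>u. H \<tturnstile> u \<epsilon> D \<and> H \<tturnstile> u \<lless> x \<and> H \<tturnstile> u \<epsilon> U)"
proof (rule locally_bind[OF approximants[OF x(1)]], elim exE conjE)
  fix H A
  assume GH: "G \<preceq> H" and A: "H \<tturnstile> directed_fm D R A" "H \<tturnstile> sup_fm D R A x"
    "\<forall>K y. H \<preceq> K \<longrightarrow> (K \<tturnstile> y \<epsilon> A \<longleftrightarrow> K \<tturnstile> y \<epsilon> D \<and> K \<tturnstile> y \<lless> x)"
  have "locally H (\<lambda>K. \<exists>s. K \<tturnstile> s \<epsilon> A \<and> K \<tturnstile> s \<epsilon> U)"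
    using forces_mono[OF op GH] forces_mono[OF x(2) GH] A(1,2) unfolding scott_open_iff by blast
  then show "locally H (\<lambda>H. \<exists>u. H \<tturnstile> u \<epsilon> D \<and> H \<tturnstile> u \<lless> x \<and> H \<tturnstile> u \<epsilon> U)"
    by (rule locally_mono) (use A(3) in blast)
qed

text \<open>The one-sided form, from which both orientations of apartness follow. Here
  \<open>v \<lless> u \<lless> x\<close>. If \<open>v \<lless> z\<close>, then \<open>z\<close> lies
  in \<open>U\<close> by upward closure, so the given \<open>U\<close> already separates
  \<open>z\<close> from \<open>y\<close>; this is why \<open>v\<close> must be in \<open>U\<close>.
  Otherwise \<open>u\<close> is not below \<open>z\<close>, and \<open>u \<lless> x\<close>
  separates \<open>x\<close> from \<open>z\<close>.\<close>

lemma sharp_cotransitive: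
  assumes x: "G \<tturnstile> x \<epsilon> D" and z: "G \<tturnstile> sharp_fm D R z" and xy: "G \<tturnstile> scott_nle_fm D R x y"
  shows "locally G (\<lambda>H. H \<tturnstile> scott_nle_fm D R x z \<or> H \<tturnstile> scott_nle_fm D R z y)"
proof (rule locally_bind[OF xy[unfolded scott_nle_iff]], elim exE conjE)
  fix H U assume GH: "G \<preceq> H"
    and U: "H \<tturnstile> scott_open_fm D R U" "H \<tturnstile> x \<epsilon> U" "H \<tturnstile> FNot (y \<epsilon> U)"
  show "locally H (\<lambda>H. H \<tturnstile> scott_nle_fm D R x z \<or> H \<tturnstile> scott_nle_fm D R z y)"
  proof (rule locally_bind[OF scott_open_approximant[OF U(1) forces_mono[OF x GH] U(2)]],
      elim exE conjE)
    fix K u assume HK: "H \<preceq> K" and u: "K \<tturnstile> u \<epsilon> D" "K \<tturnstile> u \<lless> x" "K \<tturnstile> u \<epsilon> U"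
    show "locally K (\<lambda>H. H \<tturnstile> scott_nle_fm D R x z \<or> H \<tturnstile> scott_nle_fm D R z y)"
    proof (rule locally_bind[OF scott_open_approximant[OF forces_mono[OF U(1) HK] u(1,3)]],
        elim exE conjE)
      fix L v assume KL: "K \<preceq> L" and v: "L \<tturnstile> v \<epsilon> D" "L \<tturnstile> v \<lless> u" "L \<tturnstile> v \<epsilon> U"
      have GL: "G \<preceq> L" using GH HK KL by blast
      note uL = u[THEN forces_mono, OF KL]
      show "locally L (\<lambda>H. H \<tturnstile> scott_nle_fm D R x z \<or> H \<tturnstile> scott_nle_fm D R z y)"
      proof (rule locally_mono[OF sharp_dest[OF forces_mono[OF z GL] v(1) uL(1) v(2)]], elim disjE)
        fix M assume LM: "L \<preceq> M" and vz: "M \<tturnstile> v \<lless> z"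
        have HM: "H \<preceq> M" using HK KL LM by blast
        note UM = U[THEN forces_mono, OF HM] and vM = v[THEN forces_mono, OF LM]
        have zM: "M \<tturnstile> z \<epsilon> D" using sharp_mem[OF z] GL LM by (blast intro: forces_mono)
        have "M \<tturnstile> v \<sqsubseteq> z" using vM(1) zM vz by (rule way_below_imp_le)
        then have "M \<tturnstile> z \<epsilon> U" using UM(1) vM(3) zM unfolding scott_open_iff by blast
        then have "M \<tturnstile> scott_nle_fm D R z y"
          unfolding scott_nle_iff using UM by (blast intro: locallyI)
        then show "M \<tturnstile> scott_nle_fm D R x z \<or> M \<tturnstile> scott_nle_fm D R z y" ..
      next
        fix M assume LM: "L \<preceq> M" and nle: "M \<tturnstile> FNot (u \<sqsubseteq> z)"
        have GM: "G \<preceq> M" using GL LM by blast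
        note uM = uL[THEN forces_mono, OF LM]
        have "M \<tturnstile> scott_nle_fm D R x z"
          using uM(1) forces_mono[OF x GM] uM(2) nle by (rule scott_nleI)
        then show "M \<tturnstile> scott_nle_fm D R x z \<or> M \<tturnstile> scott_nle_fm D R z y" ..
      qed
    qed
  qed
qed

text \<open>The two sides of the apartness of \<open>x\<close> and \<open>y\<close> are treated
  alike with \<open>x\<close> and \<open>y\<close> exchanged; \<open>apart_sym\<close> turns
  apartness from \<open>z\<close> into the orientation required.\<close>

lemma sharp_apart:
  assumes x: "G \<tturnstile> x \<epsilon> D" and y: "G \<tturnstile> y \<epsilon> D" and z: "G \<tturnstile> sharp_fm D R z"
    and xy: "G \<tturnstile> apart_fm D R x y"
  shows "G \<tturnstile> FOr (apart_fm D R x z) (apart_fm D R y z)"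
  unfolding forces_or
proof (rule locally_bind[OF xy[unfolded apart_fm_def forces_or]], elim disjE)
  fix H assume GH: "G \<preceq> H" and "H \<tturnstile> scott_nle_fm D R x y"
  then have "locally H (\<lambda>K. K \<tturnstile> scott_nle_fm D R x z \<or> K \<tturnstile> scott_nle_fm D R z y)"
    using x z by (blast intro: sharp_cotransitive forces_mono)
  then show "locally H (\<lambda>H. H \<tturnstile> apart_fm D R x z \<or> H \<tturnstile> apart_fm D R y z)"
    by (rule locally_mono) (blast intro: scott_nle_apart apart_sym)
next
  fix H assume GH: "G \<preceq> H" and "H \<tturnstile> scott_nle_fm D R y x"
  then have "locally H (\<lambda>K. K \<tturnstile> scott_nle_fm D R y z \<or> K \<tturnstile> scott_nle_fm D R z x)"
    using y z by (blast intro: sharp_cotransitive forces_mono)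
  then show "locally H (\<lambda>H. H \<tturnstile> apart_fm D R x z \<or> H \<tturnstile> apart_fm D R y z)"
    by (rule locally_mono) (blast intro: scott_nle_apart apart_sym)
qed

end

section \<open>The classical counterpart\<close>

text \<open>By excluded middle the complement of a principal lower set is Scott open.\<close>

lemma scott_nle_if_not_le:
  assumes "partial_order_on D r" "x \<in> D" "y \<in> D" "(x, y) \<notin> r"
  shows "scott_nle D r x y"
  unfolding scott_nle_def
proof (intro exI conjI)
  have "refl_on D r" and tr: "trans r"
    using assms(1) by (auto simp: partial_order_on_def preorder_on_def)
  then have "(y, y) \<in> r" using assms(3) by (blast dest: refl_onD)
  then show "y \<notin> {w \<in> D. (w, y) \<notin> r}" by simp
  show "x \<in> {w \<in> D. (w, y) \<notin> r}" using assms by simp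
  \<comment> \<open>Inaccessibility by contradiction: if all of \<open>S\<close> were below
    \<open>y\<close>, then \<open>y\<close> would be an upper bound and the supremum would lie below
    \<open>y\<close>.\<close>
  show "scott_open D r {w \<in> D. (w, y) \<notin> r}"
    unfolding scott_open_def directed_in_def is_sup_def
    using assms(3) tr by (auto dest: transD) blast
qed

theorem theorem5p15:
  fixes D :: "'a set" and r :: "'a rel"
  shows
    "([] \<turnstile> (\<^bold>\<forall>D. \<^bold>\<forall>R. f_continuous_dcpo D R \<^bold>\<longrightarrow>
        ((\<^bold>\<forall>y. y \<^bold>\<in> D \<^bold>\<longrightarrow> f_sharp D R y \<^bold>\<longrightarrow>
            (\<^bold>\<forall>x. x \<^bold>\<in> D \<^bold>\<longrightarrow> \<^bold>\<not> f_scott_nle D R x y \<^bold>\<longrightarrow> f_le R x y)) \<^bold>\<and>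
         (\<^bold>\<forall>x. x \<^bold>\<in> D \<^bold>\<longrightarrow> (\<^bold>\<forall>y. y \<^bold>\<in> D \<^bold>\<longrightarrow> f_sharp D R x \<^bold>\<longrightarrow> f_sharp D R y \<^bold>\<longrightarrow>
            \<^bold>\<not> f_apart D R x y \<^bold>\<longrightarrow> x \<^bold>= y)) \<^bold>\<and>
         (\<^bold>\<forall>x. x \<^bold>\<in> D \<^bold>\<longrightarrow> (\<^bold>\<forall>y. y \<^bold>\<in> D \<^bold>\<longrightarrow> (\<^bold>\<forall>z. z \<^bold>\<in> D \<^bold>\<longrightarrow> f_sharp D R z \<^bold>\<longrightarrow>
            f_apart D R x y \<^bold>\<longrightarrow> f_apart D R x z \<^bold>\<or> f_apart D R y z))))) 0)
     \<and>
     (continuous_dcpo D r \<longrightarrow>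
        (\<forall>y\<in>D. sharp D r y \<longrightarrow> (\<forall>x\<in>D. \<not> scott_nle D r x y \<longrightarrow> (x, y) \<in> r)) \<and>
        (\<forall>x\<in>D. \<forall>y\<in>D. sharp D r x \<longrightarrow> sharp D r y \<longrightarrow> \<not> apart D r x y \<longrightarrow> x = y) \<and>
        (\<forall>x\<in>D. \<forall>y\<in>D. \<forall>z\<in>D. sharp D r z \<longrightarrow> apart D r x y \<longrightarrow> apart D r x z \<or> apart D r y z))"
  (is "([] \<turnstile> ?constructive) \<and> (_ \<longrightarrow> ?tight \<and> ?antisym \<and> ?cotransitive)")
proof (intro conjI impI)
  \<comment> \<open>\<open>R\<close> is bound by the inner quantifier and so has index 0, which
    leaves index 1 for \<open>D\<close>.\<close>
  let ?D = "Suc 0" and ?R = "0 :: nat"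
  let ?D1 = "Suc ?D" and ?D2 = "Suc (Suc ?D)" and ?D3 = "Suc (Suc (Suc ?D))"
  let ?R1 = "Suc ?R" and ?R2 = "Suc (Suc ?R)" and ?R3 = "Suc (Suc (Suc ?R))"
  define concl where "concl =
    FAnd (FAll (FImp (FMem 0 ?D1) (FImp (sharp_fm ?D1 ?R1 0) (FAll (FImp (FMem 0 ?D2)
      (FImp (FNot (scott_nle_fm ?D2 ?R2 0 (Suc 0))) (le_fm ?R2 0 (Suc 0))))))))
    (FAnd (FAll (FImp (FMem 0 ?D1) (FAll (FImp (FMem 0 ?D2)
      (FImp (sharp_fm ?D2 ?R2 (Suc 0)) (FImp (sharp_fm ?D2 ?R2 0)
        (FImp (FNot (apart_fm ?D2 ?R2 (Suc 0) 0)) (FEq (Suc 0) 0))))))))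
    (FAll (FImp (FMem 0 ?D1) (FAll (FImp (FMem 0 ?D2) (FAll (FImp (FMem 0 ?D3)
      (FImp (sharp_fm ?D3 ?R3 0) (FImp (apart_fm ?D3 ?R3 (Suc (Suc 0)) (Suc 0))
        (FOr (apart_fm ?D3 ?R3 (Suc (Suc 0)) 0) (apart_fm ?D3 ?R3 (Suc 0) 0)))))))))))"
  have eq: "?constructive = FAll (FAll (FImp (continuous_dcpo_fm ?D ?R) concl))"
    by (simp add: concl_def connective_defs form_eqs eval_nat_numeral)
  have "forces ?D ?R G concl" for G
    unfolding concl_def forces_and
  proof (intro conjI, goal_cases)
    case 1
    show ?case
      \<comment> \<open>Simplification has also unfolded the negated premise into a statement about
        worlds, so the lemma is brought into the same form. The two remaining cases adapt their
        lemmas likewise, the last one for its disjunctive conclusion.\<close>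
      by (simp add: forces_simps) (intro allI impI, rule sharp_le[unfolded forces_imp])
  next
    case 2
    show ?case
      by (simp add: forces_simps) (intro allI impI, rule sharp_tight[unfolded forces_imp])
  next
    case 3
    show ?case
      by (simp add: forces_simps) (intro allI impI, rule sharp_apart[unfolded forces_or])
  qed
  from this[of "[]"] have "[continuous_dcpo_fm ?D ?R] \<turnstile> concl" unfolding forces_def .
  then have "[] \<turnstile> FImp (continuous_dcpo_fm ?D ?R) concl" by (rule derives.ImpI)
  \<comment> \<open>With the hypothesis discharged the context is empty, so the variables for
    \<open>D\<close> and \<open>R\<close> can be generalised.\<close>
  then show "[] \<turnstile> ?constructive"
    unfolding eq using derives.AllI[of "[]"] by simp
next
  assume "continuous_dcpo D r"
  then have po: "partial_order_on D r" by (simp add: continuous_dcpo_def dcpo_def)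
  then show ?tight using scott_nle_if_not_le[OF po] by blast
  have "antisym r" using po by (simp add: partial_order_on_def)
  then show ?antisym
    using scott_nle_if_not_le[OF po] unfolding apart_def by (blast dest: antisymD)
  \<comment> \<open>Let \<open>U\<close> separate two points. If \<open>z\<close> is in
    \<open>U\<close>, then \<open>U\<close> separates \<open>z\<close> from the point outside; if
    not, it separates the point inside from \<open>z\<close>.\<close>
  show ?cotransitive unfolding apart_def scott_nle_def by blast
qed

end
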